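(* Let $m_0=\sum_{i=1}^N a_i\delta_{x_i}$ be a discrete dyadic measure on $\mathbb{T}$ which satisfies the Non Degenerate Source Condition. Then, for $n$ large enough, there exists $\varepsilon^n\in\{+1,-1\}^N$ such that $$\operatorname{supp}^{\pm}(m_0)\subset\operatorname{Ext}^{\pm}_{\mathcal{G}_n}(m_0)\subset\operatorname{supp}^{\pm}(m_0)\cup\Big(\operatorname{supp}^{\pm}(m_0)+\frac{\varepsilon^n}{2^n}\Big),$$ where $\operatorname{supp}^{\pm}(m_0)+\frac{\varepsilon^n}{2^n}=\big\{\big(x_i+\frac{\varepsilon^n_i}{2^n},\eta_0^{\mathcal{G}_n}(x_i)\big):1\le i\le N\big\}$.
   Context: $\mathbb{T}=\mathbb{R}/\mathbb{Z}$. $\mathcal{M}(\mathbb{T})$ is the space of real Radon measures on $\mathbb{T}$ and $\|m\|_{TV}=\sup\{\int\psi\,dm:\psi\in C(\mathbb{T}),\|\psi\|_\infty\le1\}$. Fix a real-valued $\varphi\in C^2(\mathbb{T})$ and let $\Phi:\mathcal{M}(\mathbb{T})\to L^2(\mathbb{T})$, $(\Phi m)(t)=\int_{\mathbb{T}}\varphi(x-t)\,dm(x)$, with adjoint $\Phi^*:L^2(\mathbb{T})\to C(\mathbb{T})$, $(\Phi^*p)(t)=\int_{\mathbb{T}}\varphi(t-x)p(x)\,dx$. Put $y_0=\Phi m_0$. In $m_0=\sum_{i=1}^N a_i\delta_{x_i}$ the $a_i$ are nonzero reals and the $x_i$ pairwise distinct; $\operatorname{supp}^{\pm}(m_0)=\{(x_i,\operatorname{sign}a_i):1\le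 i\le N\}$. It is dyadic if for some $n_0\in\mathbb{N}$ every $x_i$ is of the form $j_i/2^{n_0}$ with $0\le j_i\le2^{n_0}-1$. $\partial\|m\|_{TV}=\{\eta\in C(\mathbb{T}):\|\eta\|_\infty\le1,\ \int\eta\,dm=\|m\|_{TV}\}$. $\mathcal{D}_0(y_0)$ is the problem $\sup\{\langle y_0,p\rangle:p\in L^2(\mathbb{T}),\ \|\Phi^*p\|_\infty\le1\}$; when it has a solution, $\eta_0=\Phi^*p_0$ where $p_0$ is its solution of minimal $L^2$ norm. Non Degenerate Source Condition for $m_0$: there exists $\eta\in\operatorname{Im}\Phi^*$ with $\eta\in\partial\|m_0\|_{TV}$ (this makes $\eta_0$ well defined), $|\eta_0(s)|<1$ for all $s\in\mathbb{T}\setminus\{x_1,\dots,x_N\}$, and $\eta_0''(x_i)\neq0$ for all $i$. Dyadic grids: $\mathcal{G}_n=\{j/2^n:0\le j\le2^n-1\}$. $\|\eta\|_{\infty,\mathcal{G}_n}=\max_{t\in\mathcal{G}_n}|\eta(t)|$. $\mathcal{D}_0^{\mathcal{G}_n}(y_0)$ is $\sup\{\langle y_0,p\rangle:p\in L^2(\mathbb{T}),\ \|\Phi^*p\|_{\infty,\mathcal{G}_n}\le1\}$ (for $n\ge n_0$ it has a solution since $y_0$ is the image under $\Phi$ of a measure supported in $\mathcal{G}_n$); $p_0^{\mathcal{G}_n}$ is its solution of minimal $L^2$ norm and $\eta_0^{\mathcal{G}_n}=\Phi^*p_0^{\mathcal{G}_n}$. $\operatorname{Ext}^{\pm}_{\mathcal{G}_n}(m_0)=\{(t,v)\in\mathcal{G}_n\times\{-1,+1\}:\eta_0^{\mathcal{G}_n}(t)=v\}$.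 *)

theory Defs
  imports "HOL-Analysis.Analysis" "HOL-Library.Periodic_Fun"
begin

text \<open>
  Points of the torus \<open>\<real>/\<int>\<close> are represented by their unique representatives in \<open>[0,1)\<close>
  (so a translate of a point has to be reduced with \<^const>\<open>frac\<close>), and continuous or smooth
  functions on it by 1-periodic functions on \<open>\<real>\<close>.
\<close>

definition torus :: "real set" where
  "torus = {0..<1}"

definition torus_measure :: "real measure" where
  "torus_measure = restrict_space lborel torus"

definition C_torus :: "(real \<Rightarrow> real) set" where
  "C_torus = {f. periodic_fun_simple' f \<and> continuous_on UNIV f}"

definition C2_torus :: "(real \<Rightarrow> real) set" where
  "C2_torus = {f. periodic_fun_simple' f \<and> f differentiable_on UNIV \<and>
     deriv f differentiable_on UNIV \<and> continuous_on UNIV (deriv (deriv f))}"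

text \<open>For a finite nonempty set \<open>K\<close> the supremum is the maximum.\<close>

definition sup_norm :: "real set \<Rightarrow> (real \<Rightarrow> real) \<Rightarrow> real" where
  "sup_norm K f = (SUP t\<in>K. \<bar>f t\<bar>)"

text \<open>
  Elements of \<open>L\<^sup>2\<close> are represented by functions, without passing to classes modulo equality almost
  everywhere; values outside \<open>[0,1)\<close> are irrelevant.
\<close>

definition L2 :: "(real \<Rightarrow> real) set" where
  "L2 = {p \<in> borel_measurable torus_measure. integrable torus_measure (\<lambda>t. (p t)\<^sup>2)}"

definition L2_inner :: "(real \<Rightarrow> real) \<Rightarrow> (real \<Rightarrow> real) \<Rightarrow> real" where
  "L2_inner p q = (LINT t|torus_measure. p t * q t)"

definition L2_norm :: "(real \<Rightarrow> real) \<Rightarrow> real" where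
  "L2_norm p = sqrt (L2_inner p p)"

text \<open>
  A real Radon measure on the torus is encoded by a pair \<open>(\<mu>, \<nu>)\<close> of finite positive Borel measures
  on \<open>\<real>\<close> concentrated on \<open>[0,1)\<close>, standing for the difference \<open>\<mu> - \<nu>\<close>. The notions below depend
  on the difference only.
\<close>

type_synonym radon = "real measure \<times> real measure"

definition radon_integral :: "radon \<Rightarrow> (real \<Rightarrow> real) \<Rightarrow> real" where
  "radon_integral m f = (LINT s|fst m. f s) - (LINT s|snd m. f s)"

text \<open>
  The measure \<open>\<Sum>i=1..N. a i \<cdot> \<delta>(x i)\<close>: since \<^const>\<open>ennreal\<close> maps negative numbers to 0, the
  first component collects the atoms of positive weight and the second those of negative weight.
\<close>

definition discrete_measure :: "nat \<Rightarrow> (nat \<Rightarrow> real) \<Rightarrow> (nat \<Rightarrow> real) \<Rightarrow> radon" where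
  "discrete_measure N a x =
     (distr (point_measure {1..N} (\<lambda>i. ennreal (a i))) borel x,
      distr (point_measure {1..N} (\<lambda>i. ennreal (- a i))) borel x)"

definition TV_norm :: "radon \<Rightarrow> real" where
  "TV_norm m = (SUP \<psi>\<in>{\<psi> \<in> C_torus. sup_norm torus \<psi> \<le> 1}. radon_integral m \<psi>)"

definition TV_subdiff :: "radon \<Rightarrow> (real \<Rightarrow> real) set" where
  "TV_subdiff m = {\<eta> \<in> C_torus. sup_norm torus \<eta> \<le> 1 \<and> radon_integral m \<eta> = TV_norm m}"

definition Phi :: "(real \<Rightarrow> real) \<Rightarrow> radon \<Rightarrow> real \<Rightarrow> real" where
  "Phi \<phi> m t = radon_integral m (\<lambda>s. \<phi> (s - t))"

definition Phi_adj :: "(real \<Rightarrow> real) \<Rightarrow> (real \<Rightarrow> real) \<Rightarrow> real \<Rightarrow> real" where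
  "Phi_adj \<phi> p t = (LINT s|torus_measure. \<phi> (t - s) * p s)"

text \<open>
  The dual problem with the constraint imposed on \<open>K\<close>: the torus itself for the continuous problem,
  a grid for the discretized one. The minimal norm solution is unique only almost everywhere, but
  the associated function \<open>eta0\<close> does not depend on the choice.
\<close>

definition dual_solution :: "(real \<Rightarrow> real) \<Rightarrow> real set \<Rightarrow> (real \<Rightarrow> real) \<Rightarrow> (real \<Rightarrow> real) \<Rightarrow> bool" where
  "dual_solution \<phi> K y =
     is_arg_max (\<lambda>p. L2_inner y p) (\<lambda>p. p \<in> L2 \<and> sup_norm K (Phi_adj \<phi> p) \<le> 1)"

definition p0 :: "(real \<Rightarrow> real) \<Rightarrow> real set \<Rightarrow> (real \<Rightarrow> real) \<Rightarrow> real \<Rightarrow> real" where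
  "p0 \<phi> K y = arg_min L2_norm (dual_solution \<phi> K y)"

definition eta0 :: "(real \<Rightarrow> real) \<Rightarrow> real set \<Rightarrow> (real \<Rightarrow> real) \<Rightarrow> real \<Rightarrow> real" where
  "eta0 \<phi> K y = Phi_adj \<phi> (p0 \<phi> K y)"

definition NDSC :: "(real \<Rightarrow> real) \<Rightarrow> nat \<Rightarrow> (nat \<Rightarrow> real) \<Rightarrow> (nat \<Rightarrow> real) \<Rightarrow> bool" where
  "NDSC \<phi> N a x \<longleftrightarrow>
     (let m0 = discrete_measure N a x; \<eta>0 = eta0 \<phi> torus (Phi \<phi> m0) in
        (\<exists>\<eta> \<in> Phi_adj \<phi> ` L2. \<eta> \<in> TV_subdiff m0) \<and>
        (\<forall>s \<in> torus - x ` {1..N}. \<bar>\<eta>0 s\<bar> < 1) \<and>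
        (\<forall>i \<in> {1..N}. deriv (deriv \<eta>0) (x i) \<noteq> 0))"

definition grid :: "nat \<Rightarrow> real set" where
  "grid n = {real j / 2 ^ n | j :: nat. j \<le> 2 ^ n - 1}"

definition dyadic :: "nat \<Rightarrow> (nat \<Rightarrow> real) \<Rightarrow> bool" where
  "dyadic N x \<longleftrightarrow> (\<exists>n0. \<forall>i \<in> {1..N}. x i \<in> grid n0)"

definition eta0_grid ::
    "(real \<Rightarrow> real) \<Rightarrow> nat \<Rightarrow> (nat \<Rightarrow> real) \<Rightarrow> (nat \<Rightarrow> real) \<Rightarrow> nat \<Rightarrow> real \<Rightarrow> real" where
  "eta0_grid \<phi> N a x n = eta0 \<phi> (grid n) (Phi \<phi> (discrete_measure N a x))"

definition signed_supp :: "nat \<Rightarrow> (nat \<Rightarrow> real) \<Rightarrow> (nat \<Rightarrow> real) \<Rightarrow> (real \<times> real) set" where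
  "signed_supp N a x = {(x i, sgn (a i)) | i. i \<in> {1..N}}"

definition extended_supp ::
    "(real \<Rightarrow> real) \<Rightarrow> nat \<Rightarrow> (nat \<Rightarrow> real) \<Rightarrow> (nat \<Rightarrow> real) \<Rightarrow> nat \<Rightarrow> (real \<times> real) set" where
  "extended_supp \<phi> N a x n = {(t, v) \<in> grid n \<times> {-1, 1}. eta0_grid \<phi> N a x n t = v}"

definition shifted_supp ::
    "(real \<Rightarrow> real) \<Rightarrow> nat \<Rightarrow> (nat \<Rightarrow> real) \<Rightarrow> (nat \<Rightarrow> real) \<Rightarrow> nat \<Rightarrow> (nat \<Rightarrow> real) \<Rightarrow> (real \<times> real) set" where
  "shifted_supp \<phi> N a x n \<epsilon> =
     {(frac (x i + \<epsilon> i / 2 ^ n), eta0_grid \<phi> N a x n (x i)) | i. i \<in> {1..N}}"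

end

theory Submission
  imports Defs
begin

text \<open>
  The minimal norm certificates for the grids converge in \<open>L\<^sup>2\<close> to the one for the torus: the
  feasible sets are convex and decrease to the feasible set of the torus by density of the dyadic
  points, so the parallelogram law makes the minimizers a Cauchy sequence. Differentiating \<open>\<phi>\<close> under
  the integral, the functions \<open>\<eta>\<close> and their second derivatives converge uniformly. Away from the
  support \<open>\<bar>\<eta>\<bar>\<close> stays below 1; near \<open>x i\<close> the function \<open>sgn (a i) \<cdot> \<eta>\<close> is eventually strictly
  concave, is 1 at \<open>x i\<close> and at most 1 at the grid points, so that it can reach 1 at only one other
  grid point, adjacent to \<open>x i\<close>.
\<close>

subsection \<open>The space \<open>L\<^sup>2\<close> of the torus\<close>

text \<open>The discretized constraint bounds the certificate only at grid points: between them it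
  may exceed 1, and the constraint does not force its derivative to vanish at \<open>x i\<close>.
  Hence the argument near \<open>x i\<close> compares values on the lattice through
  \<open>x i\<close> by strict concavity, instead of using a local maximum at \<open>x i\<close>.
  Once some certificate exists, the dual solutions over a constraint set \<open>K\<close> containing
  the support are exactly the \<open>p\<close> in \<open>L2\<close> with
  \<bar>\<open>Phi_adj \<phi> p\<close>\<bar> \<le> 1 on \<open>K\<close> and value
  \<open>sgn (a i)\<close> at each \<open>x i\<close>. This replaces maximization problems that vary
  with \<open>n\<close> by minimal norm problems over nested convex closed sets, all containing the
  torus solution, and it gives the Hilbert choice in \<open>p0\<close> a meaning. On functions
  \<open>L2_inner\<close> is only semidefinite, so limits are determined up to null functions;
  distances to the chosen torus solution are therefore estimated directly, without identifying
  limits.\<close>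

lemma space_torus_measure [simp]: "space torus_measure = torus"
  by (simp add: torus_measure_def space_restrict_space torus_def)

lemma emeasure_torus_measure: "emeasure torus_measure torus = 1"
  by (simp add: torus_measure_def torus_def emeasure_restrict_space)

interpretation torus: finite_measure torus_measure
  by standard (simp add: emeasure_torus_measure)

lemma borel_measurable_torus_measure:
  fixes f :: "real \<Rightarrow> real"
  assumes "f \<in> borel_measurable borel"
  shows "f \<in> borel_measurable torus_measure"
  unfolding torus_measure_def by (rule measurable_restrict_space1) (use assms in simp)

lemma L2_measurable [measurable_dest]: "p \<in> L2 \<Longrightarrow> p \<in> borel_measurable torus_measure"
  by (simp add: L2_def)

lemma L2_integrable_mult:
  assumes "p \<in> L2" "q \<in> L2"
  shows "integrable torus_measure (\<lambda>t. p t * q t)"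
proof (rule Bochner_Integration.integrable_bound)
  show "integrable torus_measure (\<lambda>t. (p t)\<^sup>2 + (q t)\<^sup>2)"
    using assms by (auto simp: L2_def)
  show "(\<lambda>t. p t * q t) \<in> borel_measurable torus_measure"
    using assms by measurable
  have "\<bar>u * v\<bar> \<le> u\<^sup>2 + v\<^sup>2" for u v :: real
    using sum_squares_bound[of "\<bar>u\<bar>" "\<bar>v\<bar>"] mult_nonneg_nonneg[of "\<bar>u\<bar>" "\<bar>v\<bar>"]
    unfolding abs_mult power2_abs by linarith
  then show "AE t in torus_measure. norm (p t * q t) \<le> norm ((p t)\<^sup>2 + (q t)\<^sup>2)"
    by simp
qed

lemma L2_comb:
  assumes "p \<in> L2" "q \<in> L2"
  shows "(\<lambda>t. c * p t + d * q t) \<in> L2"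
proof -
  have "(\<lambda>t. (c * p t + d * q t)\<^sup>2) =
    (\<lambda>t. c\<^sup>2 * (p t)\<^sup>2 + 2 * c * d * (p t * q t) + d\<^sup>2 * (q t)\<^sup>2)"
    by (auto simp: power2_eq_square algebra_simps)
  moreover have "integrable torus_measure \<dots>"
    using assms L2_integrable_mult[OF assms] by (auto simp: L2_def)
  ultimately show ?thesis
    using assms by (auto simp: L2_def)
qed

lemma L2_diff: "p \<in> L2 \<Longrightarrow> q \<in> L2 \<Longrightarrow> (\<lambda>t. p t - q t) \<in> L2"
  using L2_comb[of p q 1 "-1"] by simp

lemma bounded_in_L2:
  assumes "f \<in> borel_measurable torus_measure" "\<And>t. \<bar>f t\<bar> \<le> B"
  shows "f \<in> L2"
proof -
  have "integrable torus_measure (\<lambda>t. (f t)\<^sup>2)"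
  proof (rule torus.integrable_const_bound)
    show "AE t in torus_measure. norm ((f t)\<^sup>2) \<le> B\<^sup>2"
      using power_mono[OF assms(2) abs_ge_zero, of _ 2] by simp
  qed (use assms in measurable)
  then show ?thesis
    using assms by (simp add: L2_def)
qed

lemma L2_integrable: "p \<in> L2 \<Longrightarrow> integrable torus_measure p"
  by (rule torus.square_integrable_imp_integrable) (simp_all add: L2_def)

lemma L2_inner_commute: "L2_inner p q = L2_inner q p"
  by (simp add: L2_inner_def mult.commute)

lemma L2_inner_comb_right:
  assumes "p \<in> L2" "q \<in> L2" "r \<in> L2"
  shows "L2_inner r (\<lambda>t. c * p t + d * q t) = c * L2_inner r p + d * L2_inner r q"
proof -
  have "(\<lambda>t. r t * (c * p t + d * q t)) = (\<lambda>t. c * (r t * p t) + d * (r t * q t))"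
    by (auto simp: algebra_simps)
  then show ?thesis
    using assms by (simp add: L2_inner_def L2_integrable_mult)
qed

lemma L2_inner_diff_right:
  "\<lbrakk>p \<in> L2; q \<in> L2; r \<in> L2\<rbrakk> \<Longrightarrow> L2_inner r (\<lambda>t. p t - q t) = L2_inner r p - L2_inner r q"
  using L2_inner_comb_right[of p q r 1 "-1"] by simp

lemma L2_inner_self_comb:
  assumes "p \<in> L2" "q \<in> L2"
  shows "L2_inner (\<lambda>t. c * p t + d * q t) (\<lambda>t. c * p t + d * q t) =
    c\<^sup>2 * L2_inner p p + 2 * c * d * L2_inner p q + d\<^sup>2 * L2_inner q q"
proof -
  let ?r = "\<lambda>t. c * p t + d * q t"
  have "L2_inner ?r ?r = c * L2_inner ?r p + d * L2_inner ?r q"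
    using assms by (intro L2_inner_comb_right L2_comb)
  also have "\<dots> = c * L2_inner p ?r + d * L2_inner q ?r"
    by (simp only: L2_inner_commute)
  also have "\<dots> = c\<^sup>2 * L2_inner p p + 2 * c * d * L2_inner p q + d\<^sup>2 * L2_inner q q"
    using assms L2_inner_commute[of q p]
    by (simp add: L2_inner_comb_right power2_eq_square algebra_simps)
  finally show ?thesis .
qed

lemma L2_inner_self_nonneg: "0 \<le> L2_inner p p"
  by (auto simp: L2_inner_def)

text \<open>A nonnegative quadratic polynomial in \<open>l\<close> has nonpositive discriminant. A
  vanishing leading coefficient does not make \<open>q\<close> the zero function, hence the separate
  case.\<close>

lemma L2_Cauchy_Schwarz:
  assumes "p \<in> L2" "q \<in> L2"
  shows "(L2_inner p q)\<^sup>2 \<le> L2_inner p p * L2_inner q q"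
proof -
  let ?A = "L2_inner p p" and ?B = "L2_inner p q" and ?C = "L2_inner q q"
  have pos: "0 \<le> ?A + 2 * l * ?B + l\<^sup>2 * ?C" for l
    using L2_inner_self_nonneg[of "\<lambda>t. 1 * p t + l * q t"] L2_inner_self_comb[OF assms, of 1 l]
    by simp
  show ?thesis
  proof (cases "?C = 0")
    case True
    \<comment> \<open>The bound \<open>pos\<close> is now affine in \<open>l\<close>; if the slope
      were nonzero, the chosen \<open>l\<close> would give it the value -1.\<close>
    have "?B = 0"
    proof (rule ccontr)
      assume "?B \<noteq> 0"
      then show False
        using pos[of "- (?A + 1) / (2 * ?B)"] True L2_inner_self_nonneg[of p] by (simp add: field_simps)
    qed
    then show ?thesis
      by (simp add: True)
  next
    case False
    then have "?C > 0"
      using L2_inner_self_nonneg[of q] by simp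
    then show ?thesis
      using pos[of "- ?B / ?C"] by (simp add: field_simps power2_eq_square)
  qed
qed

text \<open>The parallelogram law solved for the distance: a lower bound on the norm of the midpoint
  becomes an upper bound on the distance.\<close>

lemma L2_inner_self_midpoint:
  assumes "p \<in> L2" "q \<in> L2"
  shows "L2_inner (\<lambda>t. p t - q t) (\<lambda>t. p t - q t) = 2 * L2_inner p p + 2 * L2_inner q q -
    4 * L2_inner (\<lambda>t. (p t + q t) / 2) (\<lambda>t. (p t + q t) / 2)"
proof -
  have "(\<lambda>t. p t - q t) = (\<lambda>t. 1 * p t + (- 1) * q t)"
    "(\<lambda>t. (p t + q t) / 2) = (\<lambda>t. 1/2 * p t + 1/2 * q t)"
    by (auto simp: add_divide_distrib)
  then show ?thesis
    by (simp only: L2_inner_self_comb[OF assms]) (simp add: power2_eq_square algebra_simps)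
qed

text \<open>Riesz--Fischer: a fast subsequence converges almost everywhere, and Fatou's lemma turns
  this into convergence in \<open>L\<^sup>2\<close>.\<close>

lemma L2_complete:
  fixes f :: "nat \<Rightarrow> real \<Rightarrow> real"
  assumes f: "\<And>n. f n \<in> L2"
    and Cauchy: "\<And>e. e > 0 \<Longrightarrow>
      \<exists>M. \<forall>m\<ge>M. \<forall>n\<ge>M. L2_inner (\<lambda>t. f m t - f n t) (\<lambda>t. f m t - f n t) < e"
  obtains g where "g \<in> L2" "(\<lambda>n. L2_inner (\<lambda>t. f n t - g t) (\<lambda>t. f n t - g t)) \<longlonglongrightarrow> 0"
proof -
  define d where "d m n = L2_inner (\<lambda>t. f m t - f n t) (\<lambda>t. f m t - f n t)" for m n
  have f_meas [measurable]: "f n \<in> borel_measurable torus_measure" for n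
    using f by (rule L2_measurable)
  have sq_int: "integrable torus_measure (\<lambda>t. (f m t - f n t)\<^sup>2)" for m n
    using L2_diff[OF f f] by (simp add: L2_def)
  have d_nn: "(\<integral>\<^sup>+t. ennreal ((f m t - f n t)\<^sup>2) \<partial>torus_measure) = ennreal (d m n)" for m n
    unfolding d_def L2_inner_def
    using nn_integral_eq_integral[OF sq_int] by (simp add: power2_eq_square)
  \<comment> \<open>The rate \<open>(1/4)^k\<close> for squared norms becomes the summable rate
    \<open>(1/2)^k\<close> for norms.\<close>
  have "\<forall>k. \<exists>M. \<forall>m\<ge>M. \<forall>n\<ge>M. d m n < (1/4)^k"
    using Cauchy by (simp add: d_def)
  then obtain M where M: "\<And>k m n. m \<ge> M k \<Longrightarrow> n \<ge> M k \<Longrightarrow> d m n < (1/4)^k"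
    by metis
  \<comment> \<open>Adding up all earlier thresholds makes \<open>r\<close> monotone and at least
    \<open>M k\<close>, although \<open>M\<close> itself need not be monotone; the summand
    \<open>k\<close> makes it unbounded.\<close>
  define r where "r k = k + (\<Sum>i\<le>k. M i)" for k
  have r_ge: "r k \<ge> M k" "r k \<ge> k" for k
    by (auto simp: r_def intro: order.trans[OF member_le_sum[of k "{..k}" M] le_add2])
  have r_Suc: "r (Suc k) \<ge> r k" for k
    by (simp add: r_def)
  define h where "h k t = \<bar>f (r (Suc k)) t - f (r k) t\<bar>" for k t
  have h_nonneg: "0 \<le> h k t" for k t
    by (simp add: h_def)
  have h_meas [measurable]: "h k \<in> borel_measurable torus_measure" for k
    unfolding h_def by measurable
  have h_L2: "h k \<in> L2" for k
    using L2_diff[OF f f] by (simp add: L2_def h_def)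
  \<comment> \<open>Cauchy-Schwarz against the constant 1, whose norm is 1 because the torus has
    mass 1.\<close>
  have h_int: "(LINT t|torus_measure. h k t) \<le> (1/2)^k" for k
  proof -
    have one: "(\<lambda>t. 1) \<in> L2"
      by (rule bounded_in_L2[of _ 1]) auto
    have "(LINT t|torus_measure. h k t)\<^sup>2 \<le> d (r (Suc k)) (r k)"
      using L2_Cauchy_Schwarz[OF h_L2 one, of k] emeasure_torus_measure
      by (simp add: L2_inner_def d_def h_def measure_def)
    also have "\<dots> < (1/4)^k"
      by (rule M) (use r_ge[of k] r_Suc[of k] in auto)
    also have "(1/4::real)^k = ((1/2)^k)\<^sup>2"
      by (simp add: power2_eq_square flip: power_mult_distrib)
    finally show ?thesis
      by (meson less_imp_le power2_le_imp_le zero_le_divide_1_iff zero_le_numeral zero_le_power)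
  qed
  have "(\<integral>\<^sup>+t. (\<Sum>k. ennreal (h k t)) \<partial>torus_measure) = (\<Sum>k. \<integral>\<^sup>+t. ennreal (h k t) \<partial>torus_measure)"
    by (rule nn_integral_suminf) measurable
  also have "\<dots> \<le> (\<Sum>k. ennreal ((1/2)^k))"
  proof (rule suminf_le)
    show "(\<integral>\<^sup>+t. ennreal (h k t) \<partial>torus_measure) \<le> ennreal ((1/2)^k)" for k
      using h_int[of k] nn_integral_eq_integral[OF L2_integrable[OF h_L2], of k]
      by (simp add: ennreal_leI h_nonneg)
  qed auto
  also have "\<dots> < top"
    unfolding less_top[symmetric] by (intro ennreal_suminf_neq_top summable_geometric) auto
  finally have fin: "(\<integral>\<^sup>+t. (\<Sum>k. ennreal (h k t)) \<partial>torus_measure) \<noteq> \<infinity>"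
    by (metis infinity_ennreal_def less_irrefl)
  have "AE t in torus_measure. (\<Sum>k. ennreal (h k t)) \<noteq> \<infinity>"
    by (rule nn_integral_PInf_AE[OF _ fin]) measurable
  then have conv: "AE t in torus_measure. convergent (\<lambda>k. f (r k) t)"
  proof eventually_elim
    case (elim t)
    then have "(\<Sum>k. ennreal (h k t)) \<noteq> top"
      by (metis infinity_ennreal_def)
    then have "summable (\<lambda>k. h k t)"
      by (rule summable_suminf_not_top[OF h_nonneg])
    then have "summable (\<lambda>k. f (r (Suc k)) t - f (r k) t)"
      unfolding h_def by (rule summable_rabs_cancel)
    then have "convergent (\<lambda>k. f (r k) t - f (r 0) t)"
      unfolding summable_iff_convergent sum_lessThan_telescope[of "\<lambda>k. f (r k) t"] .
    then show ?case
      unfolding convergent_diff_const_right_iff .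
  qed
  \<comment> \<open>On the null set where the subsequence diverges \<open>lim\<close> is an
    arbitrary value.\<close>
  define g where "g t = lim (\<lambda>k. f (r k) t)" for t
  have g_meas [measurable]: "g \<in> borel_measurable torus_measure"
    unfolding g_def by measurable
  have lim: "AE t in torus_measure. (\<lambda>k. f (r k) t) \<longlonglongrightarrow> g t"
    using conv by eventually_elim (simp add: g_def convergent_LIMSEQ_iff)
  \<comment> \<open>Only the second index runs along the subsequence. The bound thus holds for every
    \<open>n \<ge> M k\<close>, and convergence of the whole sequence follows at once.\<close>
  have fatou: "(\<integral>\<^sup>+t. ennreal ((f n t - g t)\<^sup>2) \<partial>torus_measure) \<le> ennreal ((1/4)^k)" if "n \<ge> M k" for n k
  proof -
    have "(\<integral>\<^sup>+t. ennreal ((f n t - g t)\<^sup>2) \<partial>torus_measure) =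
        (\<integral>\<^sup>+t. liminf (\<lambda>j. ennreal ((f n t - f (r j) t)\<^sup>2)) \<partial>torus_measure)"
    proof (rule nn_integral_cong_AE)
      show "AE t in torus_measure. ennreal ((f n t - g t)\<^sup>2) =
          liminf (\<lambda>j. ennreal ((f n t - f (r j) t)\<^sup>2))"
        using lim
      proof eventually_elim
        case (elim t)
        then have "(\<lambda>j. ennreal ((f n t - f (r j) t)\<^sup>2)) \<longlonglongrightarrow> ennreal ((f n t - g t)\<^sup>2)"
          by (intro tendsto_intros)
        then show ?case
          by (rule lim_imp_Liminf[OF sequentially_bot, symmetric])
      qed
    qed
    also have "\<dots> \<le> liminf (\<lambda>j. \<integral>\<^sup>+t. ennreal ((f n t - f (r j) t)\<^sup>2) \<partial>torus_measure)"
      by (rule nn_integral_liminf) measurable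
    also have "\<dots> \<le> liminf (\<lambda>j. ennreal ((1/4)^k))"
    proof (rule Liminf_mono)
      show "\<forall>\<^sub>F j in sequentially. (\<integral>\<^sup>+t. ennreal ((f n t - f (r j) t)\<^sup>2) \<partial>torus_measure) \<le> ennreal ((1/4)^k)"
        using eventually_ge_at_top[of "M k"]
      proof eventually_elim
        case (elim j)
        then show ?case
          unfolding d_nn using M[OF that, of "r j"] r_ge(2)[of j] by (simp add: ennreal_leI less_imp_le)
      qed
    qed
    also have "\<dots> = ennreal ((1/4)^k)"
      by (simp add: Liminf_const)
    finally show ?thesis .
  qed
  have diff_int: "integrable torus_measure (\<lambda>t. (f n t - g t)\<^sup>2)" if "n \<ge> M k" for n k
  proof (rule integrableI_nonneg)
    show "(\<integral>\<^sup>+t. ennreal ((f n t - g t)\<^sup>2) \<partial>torus_measure) < \<infinity>"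
      by (rule le_less_trans[OF fatou[OF that]]) simp
  qed auto
  \<comment> \<open>So far only differences with \<open>g\<close> are known to be square integrable;
    \<open>g\<close> is recovered as \<open>f (M 0)\<close> minus such a difference.\<close>
  have diff_L2: "(\<lambda>t. f (M 0) t - g t) \<in> L2"
    using diff_int[of 0] by (simp add: L2_def)
  have "g \<in> L2"
    using L2_diff[OF f diff_L2, of "M 0"] by simp
  moreover have "(\<lambda>n. L2_inner (\<lambda>t. f n t - g t) (\<lambda>t. f n t - g t)) \<longlonglongrightarrow> 0"
  proof (rule LIMSEQ_I)
    fix e :: real
    assume "e > 0"
    then obtain k where k: "(1/4)^k < e"
      using real_arch_pow_inv[of e "1/4"] by auto
    have "norm (L2_inner (\<lambda>t. f n t - g t) (\<lambda>t. f n t - g t) - 0) < e" if "n \<ge> M k" for n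
    proof -
      have "ennreal (L2_inner (\<lambda>t. f n t - g t) (\<lambda>t. f n t - g t)) \<le> ennreal ((1/4)^k)"
        using fatou[OF that] nn_integral_eq_integral[OF diff_int[OF that]]
        by (simp add: L2_inner_def power2_eq_square)
      then show ?thesis
        using k L2_inner_self_nonneg[of "\<lambda>t. f n t - g t"] by (simp add: ennreal_le_iff)
    qed
    then show "\<exists>no. \<forall>n\<ge>no. norm (L2_inner (\<lambda>t. f n t - g t) (\<lambda>t. f n t - g t) - 0) < e"
      by blast
  qed
  ultimately show ?thesis
    by (rule that)
qed

section \<open>Strong convergence and elements of minimal norm\<close>

lemma L2_inner_tendsto:
  assumes "\<And>n. f n \<in> L2" "g \<in> L2" "h \<in> L2"
    and "(\<lambda>n. L2_inner (\<lambda>t. f n t - g t) (\<lambda>t. f n t - g t)) \<longlonglongrightarrow> 0"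
  shows "(\<lambda>n. L2_inner h (f n)) \<longlonglongrightarrow> L2_inner h g"
proof -
  let ?D = "\<lambda>n. L2_inner (\<lambda>t. f n t - g t) (\<lambda>t. f n t - g t)"
  have "(\<lambda>n. (L2_inner h (f n) - L2_inner h g)\<^sup>2) \<longlonglongrightarrow> 0"
  proof (rule tendsto_sandwich[OF always_eventually always_eventually tendsto_const])
    show "\<forall>n. (L2_inner h (f n) - L2_inner h g)\<^sup>2 \<le> L2_inner h h * ?D n"
      using L2_Cauchy_Schwarz[OF assms(3) L2_diff] assms(1-3)
      by (simp flip: L2_inner_diff_right)
    show "(\<lambda>n. L2_inner h h * ?D n) \<longlonglongrightarrow> 0"
      using tendsto_mult_left[OF assms(4), of "L2_inner h h"] by simp
  qed auto
  then show ?thesis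
    by (simp add: LIM_zero_iff)
qed

lemma L2_inner_self_tendsto:
  assumes f: "\<And>n. f n \<in> L2" and g: "g \<in> L2"
    and lim: "(\<lambda>n. L2_inner (\<lambda>t. f n t - g t) (\<lambda>t. f n t - g t)) \<longlonglongrightarrow> 0"
  shows "(\<lambda>n. L2_inner (f n) (f n)) \<longlonglongrightarrow> L2_inner g g"
proof -
  have eq: "L2_inner (f n) (f n) =
    L2_inner (\<lambda>t. f n t - g t) (\<lambda>t. f n t - g t) + 2 * L2_inner g (f n) - L2_inner g g" for n
    using L2_inner_self_comb[OF f[of n] g, of 1 "-1"] L2_inner_commute[of g "f n"] by simp
  have "(\<lambda>n. L2_inner (f n) (f n)) \<longlonglongrightarrow> 0 + 2 * L2_inner g g - L2_inner g g"
    unfolding eq by (intro tendsto_intros lim L2_inner_tendsto f g)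
  then show ?thesis
    by simp
qed

text \<open>The infima \<open>b n\<close> increase as the sets shrink and are bounded by
  \<open>B\<close>, hence converge. The midpoint of \<open>q m\<close> and \<open>q n\<close> lies
  in the larger of the two sets, so its squared norm is at least the corresponding infimum, and the
  parallelogram law bounds the distance. The slack \<open>1 / Suc n\<close> lets the lemma serve
  both for minimizing sequences in one fixed set, before a minimizer is known to exist, and for
  exact minimizers over shrinking sets.\<close>

lemma L2_almost_minimal_tendsto:
  fixes F :: "nat \<Rightarrow> (real \<Rightarrow> real) set"
  assumes F: "\<And>n. F n \<subseteq> L2" "decseq F"
    and mid: "\<And>n p q. p \<in> F n \<Longrightarrow> q \<in> F n \<Longrightarrow> (\<lambda>t. (p t + q t) / 2) \<in> F n"
    and q: "\<And>n. q n \<in> F n" "\<And>n p. p \<in> F n \<Longrightarrow> L2_inner (q n) (q n) \<le> L2_inner p p + 1 / Suc n"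
    and B: "\<And>n. L2_inner (q n) (q n) \<le> B"
  obtains g where "g \<in> L2" "(\<lambda>n. L2_inner (\<lambda>t. q n t - g t) (\<lambda>t. q n t - g t)) \<longlonglongrightarrow> 0"
proof -
  let ?s = "\<lambda>p. L2_inner p p"
  define b where "b n = (INF p\<in>F n. ?s p)" for n
  have bdd: "bdd_below (?s ` F n)" for n
    by (rule bdd_belowI2[of _ 0]) (rule L2_inner_self_nonneg)
  have b_le: "b n \<le> ?s p" if "p \<in> F n" for n p
    unfolding b_def using bdd that by (rule cINF_lower)
  have b_ge: "?s (q n) - 1 / Suc n \<le> b n" for n
    unfolding b_def using q(1)[of n] q(2)[of _ n] by (intro cINF_greatest) (auto simp: algebra_simps)
  have "incseq b"
  proof (rule incseq_SucI)
    show "b n \<le> b (Suc n)" for n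
      unfolding b_def[of "Suc n"] using q(1)[of "Suc n"] F(2) b_le
      by (intro cINF_greatest) (auto simp: decseq_Suc_iff)
  qed
  moreover have "b n \<le> B" for n
    using b_le[OF q(1)] B order.trans by blast
  ultimately obtain L where L: "b \<longlonglongrightarrow> L"
    using incseq_convergent[of b B] by blast
  have inv0: "(\<lambda>n. 1 / real (Suc n)) \<longlonglongrightarrow> 0"
    using LIMSEQ_inverse_real_of_nat by (simp add: inverse_eq_divide)
  \<comment> \<open>The terms in \<open>L\<close> cancel; they are inserted so that each bracket
    tends to 0.\<close>
  have dist: "?s (\<lambda>t. q m t - q n t) \<le> 2 * (?s (q m) - L) + 2 * (?s (q n) - L) + 4 * (L - b n)" if "m \<ge> n" for m n
  proof -
    have "q m \<in> F n"
      using q(1) F(2) that by (auto simp: decseq_def)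
    then have "b n \<le> ?s (\<lambda>t. (q m t + q n t) / 2)"
      by (intro b_le mid q(1))
    moreover have "q m \<in> L2" "q n \<in> L2"
      using q(1) F(1) by auto
    ultimately show ?thesis
      using L2_inner_self_midpoint[of "q m" "q n"] by simp
  qed
  have sq: "(\<lambda>n. ?s (q n)) \<longlonglongrightarrow> L"
  proof (rule tendsto_sandwich[OF always_eventually always_eventually L])
    show "\<forall>n. b n \<le> ?s (q n)" "\<forall>n. ?s (q n) \<le> b n + 1 / Suc n"
      using b_le[OF q(1)] b_ge by (auto simp: algebra_simps)
    show "(\<lambda>n. b n + 1 / Suc n) \<longlonglongrightarrow> L"
      using tendsto_add[OF L inv0] by simp
  qed
  have Cauchy: "\<exists>M. \<forall>m\<ge>M. \<forall>n\<ge>M. ?s (\<lambda>t. q m t - q n t) < e" if "e > 0" for e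
  proof -
    \<comment> \<open>The coefficients 2, 2 and 4 in \<open>dist\<close> add up to 8.\<close>
    obtain M where M: "\<And>n. n \<ge> M \<Longrightarrow> \<bar>?s (q n) - L\<bar> < e / 8" "\<And>n. n \<ge> M \<Longrightarrow> \<bar>b n - L\<bar> < e / 8"
      using LIMSEQ_D[OF sq, of "e/8"] LIMSEQ_D[OF L, of "e/8"] \<open>e > 0\<close>
      by (metis (no_types, lifting) divide_pos_pos max.bounded_iff real_norm_def zero_less_numeral)
    have *: "?s (\<lambda>t. q m t - q n t) < e" if "m \<ge> n" "n \<ge> M" for m n
      using dist[OF that(1)] M(1)[of m] M(1)[of n] M(2)[of n] that by (auto simp: abs_if split: if_splits)
    have "?s (\<lambda>t. q m t - q n t) = ?s (\<lambda>t. q n t - q m t)" for m n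
      by (simp add: L2_inner_def algebra_simps)
    then have "?s (\<lambda>t. q m t - q n t) < e" if "m \<ge> M" "n \<ge> M" for m n
      using *[of m n] *[of n m] that by (metis nat_le_linear)
    then show ?thesis by blast
  qed
  obtain g where "g \<in> L2" "(\<lambda>n. ?s (\<lambda>t. q n t - g t)) \<longlonglongrightarrow> 0"
    by (rule L2_complete[of q]) (use q(1) F(1) Cauchy in \<open>auto simp: subset_iff\<close>)
  then show ?thesis by (rule that)
qed

text \<open>A minimizing sequence converges by the preceding lemma for a constant family of sets,
  and closedness keeps its limit in \<open>F\<close>.\<close>

lemma L2_minimal_norm_exists:
  fixes F :: "(real \<Rightarrow> real) set"
  assumes F: "F \<subseteq> L2" "F \<noteq> {}"
    and mid: "\<And>p q. p \<in> F \<Longrightarrow> q \<in> F \<Longrightarrow> (\<lambda>t. (p t + q t) / 2) \<in> F"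
    and closed: "\<And>f g. (\<And>n::nat. f n \<in> F) \<Longrightarrow> g \<in> L2 \<Longrightarrow>
      (\<lambda>n. L2_inner (\<lambda>t. f n t - g t) (\<lambda>t. f n t - g t)) \<longlonglongrightarrow> 0 \<Longrightarrow> g \<in> F"
  obtains g where "g \<in> F" "\<And>p. p \<in> F \<Longrightarrow> L2_inner g g \<le> L2_inner p p"
proof -
  let ?s = "\<lambda>p. L2_inner p p"
  define b where "b = (INF p\<in>F. ?s p)"
  have bdd: "bdd_below (?s ` F)"
    by (rule bdd_belowI2[of _ 0]) (rule L2_inner_self_nonneg)
  have b_le: "b \<le> ?s p" if "p \<in> F" for p
    unfolding b_def using bdd that by (rule cINF_lower)
  have "\<exists>p\<in>F. ?s p < b + 1 / Suc n" for n :: nat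
    using F(2) cINF_less_iff[OF F(2) bdd, of "b + 1 / Suc n"] by (simp add: b_def)
  then obtain q where q: "\<And>n. q n \<in> F" "\<And>n. ?s (q n) < b + 1 / Suc n"
    by metis
  have min: "?s (q n) \<le> ?s p + 1 / Suc n" if "p \<in> F" for n p
    using q(2)[of n] b_le[OF that] by simp
  have B: "?s (q n) \<le> b + 1" for n
    using q(2)[of n] by (rule order.trans[OF less_imp_le]) simp
  obtain g where g: "g \<in> L2" "(\<lambda>n. L2_inner (\<lambda>t. q n t - g t) (\<lambda>t. q n t - g t)) \<longlonglongrightarrow> 0"
    by (rule L2_almost_minimal_tendsto[of "\<lambda>_. F" q "b + 1"]) (use F mid q(1) min B in \<open>auto simp: decseq_def\<close>)
  have "g \<in> F"
    using q(1) g by (rule closed)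
  moreover have "?s g \<le> ?s p" if "p \<in> F" for p
  proof (rule LIMSEQ_le)
    show "(\<lambda>n. ?s (q n)) \<longlonglongrightarrow> ?s g"
      by (rule L2_inner_self_tendsto) (use q(1) F(1) g in auto)
    show "(\<lambda>n. ?s p + 1 / Suc n) \<longlonglongrightarrow> ?s p"
      using tendsto_add[OF tendsto_const LIMSEQ_inverse_real_of_nat, of "?s p"]
      by (simp add: inverse_eq_divide)
  qed (use min[OF that] in auto)
  ultimately show ?thesis by (rule that)
qed

subsection \<open>Convolution operators and discrete measures\<close>

lemma C_torus_plus_int:
  assumes "f \<in> C_torus"
  shows "f (t + of_int z) = f t"
proof -
  interpret periodic_fun_simple' f
    using assms by (simp add: C_torus_def)
  show ?thesis
    by (rule plus_of_int)
qed

lemma C_torus_continuous: "f \<in> C_torus \<Longrightarrow> continuous_on A f"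
  by (auto simp: C_torus_def intro: continuous_on_subset)

lemma C_torus_frac: "f \<in> C_torus \<Longrightarrow> f (frac t) = f t"
  using C_torus_plus_int[of f "frac t" "floor t"] by (simp add: frac_def)

lemma C_torusI: "continuous_on UNIV f \<Longrightarrow> (\<And>t. f (t + 1) = f t) \<Longrightarrow> f \<in> C_torus"
  by (simp add: C_torus_def periodic_fun_simple'_def)

lemma frac_in_torus [simp]: "frac t \<in> torus"
  by (simp add: torus_def frac_ge_0 frac_lt_1)

lemma C_torus_bounded:
  assumes "f \<in> C_torus"
  obtains B where "B > 0" "\<And>t. \<bar>f t\<bar> \<le> B"
proof -
  have "bounded (f ` {0..1})"
    by (intro compact_imp_bounded compact_continuous_image C_torus_continuous assms compact_Icc)
  then obtain B where B: "B > 0" "\<And>t. t \<in> {0..1} \<Longrightarrow> \<bar>f t\<bar> \<le> B"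
    by (auto simp: bounded_pos)
  have "\<bar>f t\<bar> \<le> B" for t
    using B(2)[of "frac t"] frac_lt_1[of t] C_torus_frac[OF assms, of t] by (simp add: frac_ge_0)
  with B(1) show ?thesis by (rule that)
qed

text \<open>A real \<open>SUP\<close> carries information only for a nonempty bounded family;
  periodicity and continuity supply the bound.\<close>

lemma sup_norm_le_one_iff:
  assumes "f \<in> C_torus" "K \<noteq> {}"
  shows "sup_norm K f \<le> 1 \<longleftrightarrow> (\<forall>t\<in>K. \<bar>f t\<bar> \<le> 1)"
proof -
  obtain B where "\<And>t. \<bar>f t\<bar> \<le> B"
    using C_torus_bounded[OF assms(1)] by blast
  then have "bdd_above ((\<lambda>t. \<bar>f t\<bar>) ` K)"
    by (intro bdd_aboveI2[of _ _ B])
  then show ?thesis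
    unfolding sup_norm_def by (intro cSUP_le_iff assms)
qed

lemma zero_in_torus [simp]: "0 \<in> torus"
  by (simp add: torus_def)

lemma sup_norm_torus_le_one_iff:
  assumes "f \<in> C_torus"
  shows "sup_norm torus f \<le> 1 \<longleftrightarrow> (\<forall>t. \<bar>f t\<bar> \<le> 1)"
proof -
  have "torus \<noteq> {}"
    using zero_in_torus by blast
  moreover have "(\<forall>t\<in>torus. \<bar>f t\<bar> \<le> 1) \<longleftrightarrow> (\<forall>t. \<bar>f t\<bar> \<le> 1)"
    by (metis C_torus_frac[OF assms] frac_in_torus)
  ultimately show ?thesis
    by (simp add: sup_norm_le_one_iff assms)
qed

lemma C_torus_measurable: "f \<in> C_torus \<Longrightarrow> f \<in> borel_measurable borel"
  by (auto simp: C_torus_def intro: borel_measurable_continuous_onI)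

lemma C_torus_reflect_measurable:
  assumes "f \<in> C_torus"
  shows "(\<lambda>s. f (t - s)) \<in> borel_measurable torus_measure"
proof (rule borel_measurable_torus_measure)
  show "(\<lambda>s. f (t - s)) \<in> borel_measurable borel"
    using C_torus_measurable[OF assms] by measurable
qed

lemma C_torus_reflect_L2:
  assumes "f \<in> C_torus"
  shows "(\<lambda>s. f (t - s)) \<in> L2"
proof -
  obtain B where "\<And>t. \<bar>f t\<bar> \<le> B"
    using C_torus_bounded[OF assms] by blast
  then show ?thesis
    by (intro bounded_in_L2[of _ B] C_torus_reflect_measurable assms)
qed

lemma Phi_adj_eq_L2_inner: "Phi_adj f p t = L2_inner (\<lambda>s. f (t - s)) p"
  by (simp add: Phi_adj_def L2_inner_def)

lemma Phi_adj_diff: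
  assumes "f \<in> C_torus" "p \<in> L2" "q \<in> L2"
  shows "Phi_adj f (\<lambda>s. p s - q s) t = Phi_adj f p t - Phi_adj f q t"
  by (simp add: Phi_adj_eq_L2_inner L2_inner_diff_right C_torus_reflect_L2 assms)

lemma Phi_adj_midpoint:
  assumes "f \<in> C_torus" "p \<in> L2" "q \<in> L2"
  shows "Phi_adj f (\<lambda>s. (p s + q s) / 2) t = (Phi_adj f p t + Phi_adj f q t) / 2"
  using L2_inner_comb_right[OF assms(2,3) C_torus_reflect_L2[OF assms(1)], of t "1/2" "1/2"]
  by (simp add: Phi_adj_eq_L2_inner add_divide_distrib)

text \<open>Cauchy-Schwarz with a bound that does not depend on \<open>t\<close>. This is what turns
  convergence in the norm of \<open>L2\<close> into uniform convergence.\<close>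

lemma Phi_adj_bound:
  assumes f: "f \<in> C_torus" "\<And>t. \<bar>f t\<bar> \<le> B" and p: "p \<in> L2"
  shows "\<bar>Phi_adj f p t\<bar> \<le> B * sqrt (L2_inner p p)"
proof -
  let ?k = "\<lambda>s. f (t - s)"
  have B: "0 \<le> B"
    using f(2)[of 0] by simp
  have "L2_inner ?k ?k \<le> (LINT s|torus_measure. B\<^sup>2)"
    unfolding L2_inner_def
  proof (rule integral_mono)
    show "?k s * ?k s \<le> B\<^sup>2" for s
      using power_mono[OF f(2) abs_ge_zero, of _ 2] by (simp add: power2_eq_square)
  qed (use L2_integrable_mult[OF C_torus_reflect_L2[OF f(1)] C_torus_reflect_L2[OF f(1)]] in auto)
  also have "\<dots> = B\<^sup>2"
    using emeasure_torus_measure by (simp add: measure_def)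
  finally have "(Phi_adj f p t)\<^sup>2 \<le> B\<^sup>2 * L2_inner p p"
    unfolding Phi_adj_eq_L2_inner
    by (intro order.trans[OF L2_Cauchy_Schwarz[OF C_torus_reflect_L2[OF f(1)] p]] mult_right_mono
        L2_inner_self_nonneg)
  also have "\<dots> = (B * sqrt (L2_inner p p))\<^sup>2"
    by (simp add: power_mult_distrib L2_inner_self_nonneg)
  finally show ?thesis
    using B L2_inner_self_nonneg[of p] by (simp add: abs_le_square_iff[symmetric])
qed

text \<open>Continuity is dominated convergence along sequences, with the majorant
  \<open>B * \<bar>p s\<bar>\<close>; it is integrable because the torus has finite measure.\<close>

lemma Phi_adj_C_torus:
  assumes f: "f \<in> C_torus" and p: "p \<in> L2"
  shows "Phi_adj f p \<in> C_torus"
proof (rule C_torusI)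
  show "Phi_adj f p (t + 1) = Phi_adj f p t" for t
    using C_torus_plus_int[OF f, of "t - _" 1] by (simp add: Phi_adj_def algebra_simps)
  obtain B where B: "\<And>t. \<bar>f t\<bar> \<le> B"
    using C_torus_bounded[OF f] by blast
  have "(\<lambda>n. Phi_adj f p (u n)) \<longlonglongrightarrow> Phi_adj f p t" if u: "u \<longlonglongrightarrow> t" for u t
    unfolding Phi_adj_def
  proof (rule integral_dominated_convergence)
    show "integrable torus_measure (\<lambda>s. B * \<bar>p s\<bar>)"
      using L2_integrable[OF p] by simp
    show "(\<lambda>s. f (u n - s) * p s) \<in> borel_measurable torus_measure"
      "(\<lambda>s. f (t - s) * p s) \<in> borel_measurable torus_measure" for n
      using C_torus_reflect_measurable[OF f] p by measurable
    have "(\<lambda>n. f (u n - s)) \<longlonglongrightarrow> f (t - s)" for s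
    proof (rule isCont_tendsto_compose[where g = f])
      show "isCont f (t - s)"
        using C_torus_continuous[OF f, of UNIV] continuous_on_eq_continuous_at by blast
    qed (intro tendsto_intros u)
    then show "AE s in torus_measure. (\<lambda>n. f (u n - s) * p s) \<longlonglongrightarrow> f (t - s) * p s"
      by (intro AE_I2 tendsto_intros)
    show "AE s in torus_measure. norm (f (u n - s) * p s) \<le> B * \<bar>p s\<bar>" for n
      using B by (auto simp: abs_mult intro!: mult_right_mono)
  qed
  then show "continuous_on UNIV (Phi_adj f p)"
    by (auto simp: continuous_on_sequentially o_def)
qed

text \<open>By the mean value inequality the difference quotients of \<open>f\<close> are bounded by
  a bound of \<open>f'\<close>, so dominated convergence applies. With \<open>f\<close> and
  \<open>f'\<close> as parameters, the lemma can be applied to \<phi> and again to its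
  derivative.\<close>

lemma Phi_adj_DERIV:
  assumes f: "f \<in> C_torus" and f': "f' \<in> C_torus" and p: "p \<in> L2"
    and deriv: "\<And>t. (f has_field_derivative f' t) (at t)"
  shows "(Phi_adj f p has_field_derivative Phi_adj f' p t) (at t)"
  unfolding DERIV_def tendsto_at_iff_sequentially o_def
proof (intro allI impI)
  fix h :: "nat \<Rightarrow> real"
  assume h: "\<forall>n. h n \<in> UNIV - {0}" "h \<longlonglongrightarrow> 0"
  obtain B where B: "\<And>t. \<bar>f' t\<bar> \<le> B"
    using C_torus_bounded[OF f'] by blast
  have lip: "\<bar>f u - f v\<bar> \<le> B * \<bar>u - v\<bar>" for u v
    using field_differentiable_bound[OF convex_UNIV, of f f' B u v] deriv B by simp
  let ?q = "\<lambda>n s. (f (t + h n - s) - f (t - s)) / h n * p s"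
  have meas: "(\<lambda>s. f (t - s)) \<in> borel_measurable torus_measure"
    "(\<lambda>s. f' (t - s)) \<in> borel_measurable torus_measure" for t
    using C_torus_reflect_measurable f f' by auto
  have "(\<lambda>n. LINT s|torus_measure. ?q n s) \<longlonglongrightarrow> (LINT s|torus_measure. f' (t - s) * p s)"
  proof (rule integral_dominated_convergence)
    show "integrable torus_measure (\<lambda>s. B * \<bar>p s\<bar>)"
      using L2_integrable[OF p] by simp
    show "(\<lambda>s. f' (t - s) * p s) \<in> borel_measurable torus_measure"
      using meas p by measurable
    show "?q n \<in> borel_measurable torus_measure" for n
      using meas p by measurable
    have "(\<lambda>n. (f ((t - s) + h n) - f (t - s)) / h n) \<longlonglongrightarrow> f' (t - s)" for s
      using deriv[of "t - s"] h unfolding DERIV_def tendsto_at_iff_sequentially o_def by blast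
    then show "AE s in torus_measure. (\<lambda>n. ?q n s) \<longlonglongrightarrow> f' (t - s) * p s"
      by (intro AE_I2 tendsto_intros) (simp add: algebra_simps)
    have "\<bar>(f (t + h n - s) - f (t - s)) / h n\<bar> \<le> B" for n s
      using lip[of "t + h n - s" "t - s"] h(1) by (auto simp: divide_le_eq)
    then show "AE s in torus_measure. norm (?q n s) \<le> B * \<bar>p s\<bar>" for n
      unfolding real_norm_def abs_mult by (intro AE_I2 mult_right_mono) auto
  qed
  moreover have "(LINT s|torus_measure. ?q n s) = (Phi_adj f p (t + h n) - Phi_adj f p t) / h n" for n
  proof -
    have "integrable torus_measure (\<lambda>s. f (t - s) * p s)" for t
      by (intro L2_integrable_mult C_torus_reflect_L2 f p)
    then show ?thesis
      by (simp add: Phi_adj_def left_diff_distrib diff_divide_distrib)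
  qed
  ultimately show "(\<lambda>n. (Phi_adj f p (t + h n) - Phi_adj f p t) / h n) \<longlonglongrightarrow> Phi_adj f' p t"
    unfolding Phi_adj_def[of f'] by (simp only:)
qed

lemma C2_torusD:
  assumes "\<phi> \<in> C2_torus"
  shows "\<phi> \<in> C_torus" "deriv \<phi> \<in> C_torus" "deriv (deriv \<phi>) \<in> C_torus"
    and "\<And>t. (\<phi> has_field_derivative deriv \<phi> t) (at t)"
    and "\<And>t. (deriv \<phi> has_field_derivative deriv (deriv \<phi>) t) (at t)"
proof -
  have DERIV: "(f has_field_derivative deriv f t) (at t)" if "f differentiable_on UNIV" for f :: "real \<Rightarrow> real" and t
    using that by (simp add: differentiable_on_def DERIV_deriv_iff_real_differentiable)
  have per: "deriv f (t + 1) = deriv f t" if "f differentiable_on UNIV" "\<And>t. f (t + 1) = f t"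
    for f :: "real \<Rightarrow> real" and t
  proof -
    have "((\<lambda>t. f (t + 1)) has_field_derivative deriv f (t + 1)) (at t)"
      using DERIV[OF that(1), of "t + 1"] unfolding DERIV_shift .
    then show ?thesis
      unfolding that(2) by (rule DERIV_imp_deriv[symmetric])
  qed
  have diff: "\<phi> differentiable_on UNIV" "deriv \<phi> differentiable_on UNIV"
    and cont: "continuous_on UNIV (deriv (deriv \<phi>))" and p: "\<phi> (t + 1) = \<phi> t" for t
    using assms by (auto simp: C2_torus_def periodic_fun_simple'_def)
  show "(\<phi> has_field_derivative deriv \<phi> t) (at t)"
    "(deriv \<phi> has_field_derivative deriv (deriv \<phi>) t) (at t)" for t
    using diff DERIV by auto
  show "\<phi> \<in> C_torus" "deriv \<phi> \<in> C_torus" "deriv (deriv \<phi>) \<in> C_torus"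
    using diff cont p per[OF diff(1)] per[OF diff(2)]
    by (auto intro!: C_torusI differentiable_imp_continuous_on)
qed

lemma deriv_deriv_Phi_adj:
  assumes "\<phi> \<in> C2_torus" "p \<in> L2"
  shows "(Phi_adj \<phi> p has_field_derivative Phi_adj (deriv \<phi>) p t) (at t)"
    and "(Phi_adj (deriv \<phi>) p has_field_derivative Phi_adj (deriv (deriv \<phi>)) p t) (at t)"
    and "deriv (deriv (Phi_adj \<phi> p)) = Phi_adj (deriv (deriv \<phi>)) p"
proof -
  note \<phi> = C2_torusD[OF assms(1)]
  show *: "(Phi_adj \<phi> p has_field_derivative Phi_adj (deriv \<phi>) p t) (at t)"
    "(Phi_adj (deriv \<phi>) p has_field_derivative Phi_adj (deriv (deriv \<phi>)) p t) (at t)" for t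
    using \<phi> assms(2) by (auto intro!: Phi_adj_DERIV)
  have "deriv (Phi_adj \<phi> p) = Phi_adj (deriv \<phi>) p"
    using *(1) by (auto intro: DERIV_imp_deriv)
  then show "deriv (deriv (Phi_adj \<phi> p)) = Phi_adj (deriv (deriv \<phi>)) p"
    using *(2) by (auto intro: DERIV_imp_deriv)
qed

section \<open>Discrete measures and the total variation norm\<close>

lemma radon_integral_discrete_measure:
  assumes [measurable]: "f \<in> borel_measurable borel"
  shows "radon_integral (discrete_measure N a x) f = (\<Sum>i=1..N. a i * f (x i))"
proof -
  have pm: "(LINT s|distr (point_measure {1..N} (\<lambda>i. ennreal (b i))) borel x. f s) =
      (\<Sum>i=1..N. max 0 (b i) * f (x i))" for b :: "nat \<Rightarrow> real"
  proof -
    have "(LINT s|distr (point_measure {1..N} (\<lambda>i. ennreal (b i))) borel x. f s) =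
        (LINT i|point_measure {1..N} (\<lambda>i. ennreal (b i)). f (x i))"
      by (rule integral_distr[OF _ assms]) (simp add: measurable_point_measure_eq1)
    \<comment> \<open>The integral formula for point measures wants nonnegative real weights,
      whereas \<open>ennreal\<close> has silently truncated the negative ones. In the end
      \<open>max 0 (a i) - max 0 (- a i) = a i\<close> reassembles the signed weight.\<close>
    also have "\<dots> = (LINT i|point_measure {1..N} (\<lambda>i. ennreal (max 0 (b i))). f (x i))"
      by (rule arg_cong[where f = "\<lambda>w. LINT i|point_measure {1..N} w. f (x i)"])
         (auto simp: fun_eq_iff max_def ennreal_neg)
    also have "\<dots> = (\<Sum>i=1..N. max 0 (b i) * f (x i))"
      by (simp add: lebesgue_integral_point_measure_finite)
    finally show ?thesis .
  qed
  show ?thesis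
    unfolding radon_integral_def discrete_measure_def fst_conv snd_conv pm
    by (simp add: sum_subtractf[symmetric]) (auto intro!: sum.cong simp: max_def algebra_simps)
qed

text \<open>Squared sines make the Lagrange basis 1-periodic.\<close>

lemma C_torus_interpolation:
  fixes x v :: "'i \<Rightarrow> real"
  assumes I: "finite I" "inj_on x I" "x ` I \<subseteq> torus" and v: "\<And>i. i \<in> I \<Longrightarrow> \<bar>v i\<bar> \<le> 1"
  obtains \<psi> where "\<psi> \<in> C_torus" "\<And>t. \<bar>\<psi> t\<bar> \<le> 1" "\<And>i. i \<in> I \<Longrightarrow> \<psi> (x i) = v i"
proof -
  define l where "l i t = (\<Prod>j\<in>I-{i}. (sin (pi * (t - x j)) / sin (pi * (x i - x j)))\<^sup>2)" for i t
  \<comment> \<open>Clipping enforces the bound 1 everywhere and leaves the nodes untouched, as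
    \<bar>\<open>v i\<close>\<bar> \<le> 1 there.\<close>
  define \<psi> where "\<psi> t = max (- 1) (min 1 (\<Sum>i\<in>I. v i * l i t))" for t
  have sin_nz: "sin (pi * (x i - x j)) \<noteq> 0" if "i \<in> I" "j \<in> I" "j \<noteq> i" for i j
  proof
    assume "sin (pi * (x i - x j)) = 0"
    then obtain k :: int where "pi * (x i - x j) = of_int k * pi"
      by (auto simp: sin_zero_iff_int2)
    then have k: "x i - x j = of_int k"
      by (simp add: mult.commute[of pi])
    moreover have "\<bar>x i - x j\<bar> < 1"
    proof -
      have "x i \<in> torus" "x j \<in> torus"
        using I(3) that by auto
      then show ?thesis
        by (auto simp: torus_def)
    qed
    ultimately have "k = 0"
      by linarith
    then show False
      using k I(2) that by (auto simp: inj_on_def)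
  qed
  have l: "l i (x k) = (if k = i then 1 else 0)" if "i \<in> I" "k \<in> I" for i k
  proof (cases "k = i")
    case True
    have "(\<Prod>j\<in>I-{i}. (sin (pi * (x i - x j)) / sin (pi * (x i - x j)))\<^sup>2) = (\<Prod>j\<in>I-{i}. 1)"
      by (rule prod.cong) (use sin_nz that in auto)
    then show ?thesis
      by (simp add: l_def True)
  next
    case False
    then have "l i (x k) = 0"
      unfolding l_def using that I(1) by (intro prod_zero bexI[of _ k]) auto
    with False show ?thesis
      by simp
  qed
  have per: "l i (t + 1) = l i t" for i t
  proof -
    have "sin (pi * (t + 1 - x j)) = - sin (pi * (t - x j))" for j
      using sin_periodic_pi[of "pi * (t - x j)"] by (simp add: algebra_simps)
    then show ?thesis
      by (simp add: l_def)
  qed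
  have "continuous_on UNIV (l i)" if "i \<in> I" for i
    unfolding l_def by (intro continuous_intros) (use sin_nz that in auto)
  then have "\<psi> \<in> C_torus"
    unfolding \<psi>_def by (intro C_torusI continuous_intros) (auto simp: per)
  moreover have "\<bar>\<psi> t\<bar> \<le> 1" for t
    by (auto simp: \<psi>_def)
  moreover have "\<psi> (x k) = v k" if "k \<in> I" for k
  proof -
    have "(\<Sum>i\<in>I. v i * l i (x k)) = (\<Sum>i\<in>I. if k = i then v i else 0)"
      by (rule sum.cong) (use l that in auto)
    then show ?thesis
      using that I(1) v[OF that] by (auto simp: \<psi>_def abs_le_iff)
  qed
  ultimately show ?thesis by (rule that)
qed

lemma sum_mult_le_sum_abs:
  fixes a u :: "'i \<Rightarrow> real"
  assumes "\<And>i. i \<in> I \<Longrightarrow> \<bar>u i\<bar> \<le> 1"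
  shows "(\<Sum>i\<in>I. a i * u i) \<le> (\<Sum>i\<in>I. \<bar>a i\<bar>)"
proof (rule sum_mono)
  fix i assume i: "i \<in> I"
  have "a i * u i \<le> \<bar>a i * u i\<bar>" by simp
  also have "\<dots> \<le> \<bar>a i\<bar>"
    unfolding abs_mult using mult_left_mono[OF assms[OF i], of "\<bar>a i\<bar>"] by simp
  finally show "a i * u i \<le> \<bar>a i\<bar>" .
qed

text \<open>The equality case of the preceding bound: nonnegative terms with sum 0 all vanish. It
  identifies both the subgradients of the total variation norm and the dual solutions.\<close>

lemma sum_mult_ge_sum_absD:
  fixes a u :: "'i \<Rightarrow> real"
  assumes I: "finite I" and u: "\<And>i. i \<in> I \<Longrightarrow> \<bar>u i\<bar> \<le> 1"
    and ge: "(\<Sum>i\<in>I. \<bar>a i\<bar>) \<le> (\<Sum>i\<in>I. a i * u i)" and i: "i \<in> I" "a i \<noteq> 0"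
  shows "u i = sgn (a i)"
proof -
  have "(\<Sum>j\<in>I. \<bar>a j\<bar> - a j * u j) = 0"
    using ge sum_mult_le_sum_abs[of I u a] u by (simp add: sum_subtractf)
  moreover have "0 \<le> \<bar>a j\<bar> - a j * u j" if "j \<in> I" for j
    using sum_mult_le_sum_abs[of "{j}" u a] u that by simp
  ultimately have "\<bar>a i\<bar> - a i * u i = 0"
    using sum_nonneg_eq_0_iff[OF I, of "\<lambda>j. \<bar>a j\<bar> - a j * u j"] i(1) by blast
  then have "a i * (sgn (a i) - u i) = 0"
    by (simp only: right_diff_distrib abs_sgn)
  then show ?thesis
    using i(2) by simp
qed

text \<open>Testing with a continuous function that interpolates the signs, which exists because the
  points are distinct, shows that the norm is at least \<Sum>\<bar>\<open>a i\<close>\<bar>. A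
  subgradient then falls under the equality case.\<close>

lemma TV_subdiff_discrete_measure:
  assumes \<eta>: "\<eta> \<in> TV_subdiff (discrete_measure N a x)"
    and x: "inj_on x {1..N}" "x ` {1..N} \<subseteq> torus" and i: "i \<in> {1..N}" "a i \<noteq> 0"
  shows "\<eta> (x i) = sgn (a i)"
proof -
  let ?m = "discrete_measure N a x"
  have \<eta>C: "\<eta> \<in> C_torus" and \<eta>1: "\<And>t. \<bar>\<eta> t\<bar> \<le> 1" and \<eta>TV: "radon_integral ?m \<eta> = TV_norm ?m"
    using \<eta> by (auto simp: TV_subdiff_def sup_norm_torus_le_one_iff)
  have int: "radon_integral ?m \<psi> = (\<Sum>i=1..N. a i * \<psi> (x i))" if "\<psi> \<in> C_torus" for \<psi>
    by (intro radon_integral_discrete_measure C_torus_measurable that)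
  obtain \<psi> where \<psi>: "\<psi> \<in> C_torus" "\<And>t. \<bar>\<psi> t\<bar> \<le> 1" "\<And>i. i \<in> {1..N} \<Longrightarrow> \<psi> (x i) = sgn (a i)"
    by (rule C_torus_interpolation[of "{1..N}" x "\<lambda>i. sgn (a i)"]) (use x in \<open>auto simp: sgn_if\<close>)
  have "radon_integral ?m \<psi> \<le> TV_norm ?m"
    unfolding TV_norm_def
  proof (rule cSUP_upper)
    show "bdd_above (radon_integral ?m ` {\<psi> \<in> C_torus. sup_norm torus \<psi> \<le> 1})"
      by (rule bdd_aboveI2[of _ _ "\<Sum>i=1..N. \<bar>a i\<bar>"])
         (auto simp: int sup_norm_torus_le_one_iff intro!: sum_mult_le_sum_abs)
  qed (use \<psi> in \<open>simp add: sup_norm_torus_le_one_iff\<close>)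
  moreover have "radon_integral ?m \<psi> = (\<Sum>i=1..N. \<bar>a i\<bar>)"
    using \<psi> by (auto simp: int abs_sgn intro!: sum.cong)
  ultimately show ?thesis
    using \<eta>1 \<eta>TV i int[OF \<eta>C] by (intro sum_mult_ge_sum_absD[of "{1..N}" "\<lambda>i. \<eta> (x i)"]) auto
qed

subsection \<open>Convergence of the minimal norm certificates\<close>

text \<open>The dual solutions in a form without maximization: only the signs of the weights remain,
  and \<open>K\<close> enters only as the range of a universal quantifier, so that refining a grid
  visibly shrinks the set.\<close>

definition certificates ::
    "(real \<Rightarrow> real) \<Rightarrow> real set \<Rightarrow> nat \<Rightarrow> (nat \<Rightarrow> real) \<Rightarrow> (nat \<Rightarrow> real) \<Rightarrow> (real \<Rightarrow> real) set" where
  "certificates \<phi> K N a x = {p \<in> L2. (\<forall>t\<in>K. \<bar>Phi_adj \<phi> p t\<bar> \<le> 1) \<and>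
     (\<forall>i\<in>{1..N}. Phi_adj \<phi> p (x i) = sgn (a i))}"

lemma certificates_antimono: "K \<subseteq> K' \<Longrightarrow> certificates \<phi> K' N a x \<subseteq> certificates \<phi> K N a x"
  by (auto simp: certificates_def)

lemma certificates_midpoint:
  assumes "\<phi> \<in> C_torus" "p \<in> certificates \<phi> K N a x" "q \<in> certificates \<phi> K N a x"
  shows "(\<lambda>t. (p t + q t) / 2) \<in> certificates \<phi> K N a x"
proof -
  have pq: "p \<in> L2" "q \<in> L2"
    using assms by (auto simp: certificates_def)
  have "(\<lambda>t. (p t + q t) / 2) \<in> L2"
    using L2_comb[OF pq, of "1/2" "1/2"] by (simp add: add_divide_distrib)
  moreover have "\<bar>Phi_adj \<phi> p t + Phi_adj \<phi> q t\<bar> \<le> 2" if "t \<in> K" for t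
    using assms that abs_triangle_ineq[of "Phi_adj \<phi> p t" "Phi_adj \<phi> q t"]
    by (fastforce simp: certificates_def)
  ultimately show ?thesis
    using assms by (simp add: certificates_def Phi_adj_midpoint)
qed

lemma Phi_adj_tendsto:
  assumes "\<phi> \<in> C_torus" "\<And>n. f n \<in> L2" "g \<in> L2"
    and "(\<lambda>n. L2_inner (\<lambda>t. f n t - g t) (\<lambda>t. f n t - g t)) \<longlonglongrightarrow> 0"
  shows "(\<lambda>n. Phi_adj \<phi> (f n) t) \<longlonglongrightarrow> Phi_adj \<phi> g t"
  unfolding Phi_adj_eq_L2_inner using assms by (intro L2_inner_tendsto C_torus_reflect_L2)

lemma certificates_closed:
  assumes \<phi>: "\<phi> \<in> C_torus" and f: "\<And>n::nat. f n \<in> certificates \<phi> K N a x" and g: "g \<in> L2"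
    and lim: "(\<lambda>n. L2_inner (\<lambda>t. f n t - g t) (\<lambda>t. f n t - g t)) \<longlonglongrightarrow> 0"
  shows "g \<in> certificates \<phi> K N a x"
proof -
  have "f n \<in> L2" for n
    using f by (auto simp: certificates_def)
  then have *: "(\<lambda>n. Phi_adj \<phi> (f n) t) \<longlonglongrightarrow> Phi_adj \<phi> g t" for t
    using \<phi> g lim by (intro Phi_adj_tendsto)
  have "\<bar>Phi_adj \<phi> g t\<bar> \<le> 1" if "t \<in> K" for t
    by (rule LIMSEQ_le_const2[OF tendsto_rabs[OF *]]) (use f that in \<open>auto simp: certificates_def\<close>)
  moreover have "Phi_adj \<phi> g (x i) = sgn (a i)" if "i \<in> {1..N}" for i
    by (rule LIMSEQ_unique[OF *]) (use f that in \<open>auto simp: certificates_def\<close>)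
  ultimately show ?thesis
    using g by (simp add: certificates_def)
qed

text \<open>The adjointness of \<open>Phi\<close> and \<open>Phi_adj\<close>; for a discrete measure
  it only exchanges a finite sum with the integral.\<close>

lemma L2_inner_Phi_discrete_measure:
  assumes \<phi>: "\<phi> \<in> C_torus" and p: "p \<in> L2"
  shows "L2_inner (Phi \<phi> (discrete_measure N a x)) p = (\<Sum>i=1..N. a i * Phi_adj \<phi> p (x i))"
proof -
  have Phi: "Phi \<phi> (discrete_measure N a x) t = (\<Sum>i=1..N. a i * \<phi> (x i - t))" for t
    unfolding Phi_def
    by (rule radon_integral_discrete_measure) (use C_torus_measurable[OF \<phi>] in measurable)
  have int: "integrable torus_measure (\<lambda>t. \<phi> (x i - t) * p t)" for i
    by (intro L2_integrable_mult C_torus_reflect_L2 \<phi> p)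
  have "L2_inner (Phi \<phi> (discrete_measure N a x)) p =
      (LINT t|torus_measure. (\<Sum>i=1..N. a i * (\<phi> (x i - t) * p t)))"
    by (simp add: L2_inner_def Phi sum_distrib_right mult.assoc)
  also have "\<dots> = (\<Sum>i=1..N. a i * Phi_adj \<phi> p (x i))"
    using int by (simp add: Phi_adj_def)
  finally show ?thesis .
qed

text \<open>The dual optimum is \<open>\<Sum>i. \<bar>a i\<bar>\<close>, which a feasible point attains only if it is a certificate.\<close>

lemma dual_solution_iff_certificate:
  assumes \<phi>: "\<phi> \<in> C_torus" and x: "x ` {1..N} \<subseteq> K" and a: "\<And>i. i \<in> {1..N} \<Longrightarrow> a i \<noteq> 0"
    and K: "K \<noteq> {}" and ex: "certificates \<phi> K N a x \<noteq> {}"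
  shows "dual_solution \<phi> K (Phi \<phi> (discrete_measure N a x)) p \<longleftrightarrow> p \<in> certificates \<phi> K N a x"
proof -
  let ?y = "Phi \<phi> (discrete_measure N a x)"
  let ?A = "\<Sum>i=1..N. \<bar>a i\<bar>"
  define P where "P p \<longleftrightarrow> p \<in> L2 \<and> sup_norm K (Phi_adj \<phi> p) \<le> 1" for p
  have P: "P p \<longleftrightarrow> p \<in> L2 \<and> (\<forall>t\<in>K. \<bar>Phi_adj \<phi> p t\<bar> \<le> 1)" for p
    using sup_norm_le_one_iff[OF Phi_adj_C_torus[OF \<phi>] K] by (auto simp: P_def)
  have xK: "x i \<in> K" if "i \<in> {1..N}" for i
    using x that by blast
  then have le: "L2_inner ?y p \<le> ?A" if "P p" for p
    using that by (auto simp: P L2_inner_Phi_discrete_measure[OF \<phi>] intro!: sum_mult_le_sum_abs)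
  have eq: "p \<in> certificates \<phi> K N a x \<longleftrightarrow> P p \<and> ?A \<le> L2_inner ?y p" for p
  proof
    assume "p \<in> certificates \<phi> K N a x"
    then show "P p \<and> ?A \<le> L2_inner ?y p"
      by (auto simp: P certificates_def L2_inner_Phi_discrete_measure[OF \<phi>] abs_sgn)
  next
    assume *: "P p \<and> ?A \<le> L2_inner ?y p"
    then have "Phi_adj \<phi> p (x i) = sgn (a i)" if "i \<in> {1..N}" for i
      using that xK a
      by (intro sum_mult_ge_sum_absD[of "{1..N}" "\<lambda>i. Phi_adj \<phi> p (x i)"])
         (auto simp: P L2_inner_Phi_discrete_measure[OF \<phi>])
    with * show "p \<in> certificates \<phi> K N a x"
      by (auto simp: P certificates_def)
  qed
  obtain q where q: "P q" "?A \<le> L2_inner ?y q"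
    using ex eq by auto
  have "dual_solution \<phi> K ?y p \<longleftrightarrow> P p \<and> (\<forall>r. P r \<longrightarrow> L2_inner ?y r \<le> L2_inner ?y p)"
    by (auto simp: dual_solution_def is_arg_max_def P_def not_less)
  also have "\<dots> \<longleftrightarrow> P p \<and> ?A \<le> L2_inner ?y p"
    using q le by (meson order.trans)
  finally show ?thesis
    using eq by simp
qed

text \<open>\<open>arg_min\<close> is a Hilbert choice, so a minimizer must first be shown to exist;
  the chosen \<open>p\<close> may differ from that witness but shares its defining property.\<close>

lemma p0_minimal_certificate:
  assumes \<phi>: "\<phi> \<in> C_torus" and x: "x ` {1..N} \<subseteq> K" and a: "\<And>i. i \<in> {1..N} \<Longrightarrow> a i \<noteq> 0"
    and K: "K \<noteq> {}" and ex: "certificates \<phi> K N a x \<noteq> {}"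
  defines "p \<equiv> p0 \<phi> K (Phi \<phi> (discrete_measure N a x))"
  shows "p \<in> certificates \<phi> K N a x"
    and "\<And>q. q \<in> certificates \<phi> K N a x \<Longrightarrow> L2_inner p p \<le> L2_inner q q"
proof -
  let ?S = "certificates \<phi> K N a x"
  have "?S \<subseteq> L2"
    by (auto simp: certificates_def)
  then have "\<exists>g\<in>?S. \<forall>q\<in>?S. L2_inner g g \<le> L2_inner q q"
    by (rule L2_minimal_norm_exists[OF _ ex certificates_midpoint[OF \<phi>] certificates_closed[OF \<phi>]])
       auto
  then obtain g where g: "g \<in> ?S" "\<And>q. q \<in> ?S \<Longrightarrow> L2_inner g g \<le> L2_inner q q"
    by blast
  have dual: "dual_solution \<phi> K (Phi \<phi> (discrete_measure N a x)) = (\<lambda>q. q \<in> ?S)"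
    using dual_solution_iff_certificate[OF \<phi> x a K ex] by auto
  have "is_arg_min L2_norm (\<lambda>q. q \<in> ?S) g"
    using g by (auto simp: is_arg_min_def L2_norm_def not_less)
  then have "is_arg_min L2_norm (\<lambda>q. q \<in> ?S) p"
    unfolding p_def p0_def dual arg_min_def
    by (rule someI[where P = "is_arg_min L2_norm (\<lambda>q. q \<in> ?S)"])
  then show "p \<in> ?S" "\<And>q. q \<in> ?S \<Longrightarrow> L2_inner p p \<le> L2_inner q q"
    by (auto simp: is_arg_min_def L2_norm_def not_less)
qed

section \<open>Dyadic grids and their density\<close>

lemma grid_iff: "t \<in> grid n \<longleftrightarrow> t \<in> torus \<and> t * 2 ^ n \<in> \<int>"
proof
  assume "t \<in> grid n"
  then obtain j :: nat where j: "t = real j / 2 ^ n" "j \<le> 2 ^ n - 1"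
    by (auto simp: grid_def)
  \<comment> \<open>The subtraction in \<open>2 ^ n - 1\<close> is truncated on the naturals;
    \<open>2 ^ n > 0\<close> turns the bound into a strict one.\<close>
  have "j < 2 ^ n"
    using j(2) zero_less_power[OF pos2, of n] by arith
  then have "real j < 2 ^ n"
    by (metis of_nat_less_iff of_nat_numeral of_nat_power)
  with j(1) show "t \<in> torus \<and> t * 2 ^ n \<in> \<int>"
    by (simp add: torus_def)
next
  assume t: "t \<in> torus \<and> t * 2 ^ n \<in> \<int>"
  then obtain k where k: "t * 2 ^ n = of_int k"
    by (auto elim: Ints_cases)
  have "0 \<le> t * 2 ^ n" "t * 2 ^ n < 2 ^ n"
    using t by (simp_all add: torus_def)
  then have "real_of_int 0 \<le> of_int k" "real_of_int k < of_int (2 ^ n)"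
    unfolding k by simp_all
  then have "0 \<le> k" "k < 2 ^ n"
    by (simp_all only: of_int_le_iff of_int_less_iff)
  then have "nat k < 2 ^ n"
    by (simp add: nat_less_iff)
  then have "nat k \<le> 2 ^ n - 1"
    by arith
  moreover have "t = real (nat k) / 2 ^ n"
    using k \<open>0 \<le> k\<close> by (simp add: field_simps)
  ultimately show "t \<in> grid n"
    unfolding grid_def by blast
qed

lemma zero_in_grid: "0 \<in> grid n"
  by (simp add: grid_iff)

lemma grid_mono:
  assumes "m \<le> n"
  shows "grid m \<subseteq> grid n"
proof
  fix t assume t: "t \<in> grid m"
  have "t * 2 ^ n = (t * 2 ^ m) * of_int (2 ^ (n - m))"
    using assms by (simp flip: power_add)
  also have "\<dots> \<in> \<int>"
    by (rule Ints_mult) (use t in \<open>simp_all add: grid_iff\<close>)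
  finally show "t \<in> grid n"
    using t by (simp add: grid_iff)
qed

text \<open>Rounding down keeps the approximations inside [0,1); rounding to the nearest multiple
  could produce 1.\<close>

lemma grid_approximation:
  assumes "t \<in> torus"
  obtains u where "\<And>n. u n \<in> grid n" "u \<longlonglongrightarrow> t"
proof
  define u where "u n = of_int \<lfloor>t * 2 ^ n\<rfloor> / (2 ^ n :: real)" for n :: nat
  have le: "u n \<le> t" for n
    by (simp add: u_def divide_le_eq)
  have ge: "t - (1/2) ^ n \<le> u n" for n
  proof -
    have "(t * 2 ^ n - 1) / 2 ^ n \<le> u n"
      unfolding u_def using floor_correct[of "t * 2 ^ n"] by (intro divide_right_mono) auto
    then show ?thesis
      by (simp add: diff_divide_distrib power_one_over)
  qed
  show "u n \<in> grid n" for n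
  proof -
    have "0 \<le> u n"
      using assms by (simp add: u_def torus_def)
    then show ?thesis
      using le[of n] assms by (simp add: grid_iff torus_def) (simp add: u_def)
  qed
  show "u \<longlonglongrightarrow> t"
  proof (rule tendsto_sandwich[OF always_eventually always_eventually _ tendsto_const])
    show "(\<lambda>n. t - (1/2) ^ n) \<longlonglongrightarrow> t"
      using tendsto_diff[OF tendsto_const LIMSEQ_realpow_zero[of "1/2"], of t] by simp
  qed (use le ge in auto)
qed

lemma certificate_torus_if_grids:
  assumes \<phi>: "\<phi> \<in> C_torus" and p: "\<And>n. n \<ge> n0 \<Longrightarrow> p \<in> certificates \<phi> (grid n) N a x"
  shows "p \<in> certificates \<phi> torus N a x"
proof -
  have pL2: "p \<in> L2"
    using p[of n0] by (simp add: certificates_def)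
  have "\<bar>Phi_adj \<phi> p t\<bar> \<le> 1" if t: "t \<in> torus" for t
  proof -
    obtain u where u: "\<And>n. u n \<in> grid n" "u \<longlonglongrightarrow> t"
      using grid_approximation[OF t] by blast
    have "isCont (Phi_adj \<phi> p) t"
      using C_torus_continuous[OF Phi_adj_C_torus[OF \<phi> pL2], of UNIV]
      by (simp add: continuous_on_eq_continuous_at)
    then have "(\<lambda>n. \<bar>Phi_adj \<phi> p (u n)\<bar>) \<longlonglongrightarrow> \<bar>Phi_adj \<phi> p t\<bar>"
      by (intro tendsto_rabs isCont_tendsto_compose[of _ "Phi_adj \<phi> p"] u)
    then show ?thesis
      by (rule LIMSEQ_le_const2)
         (use p u(1) in \<open>auto simp: certificates_def intro!: exI[of _ n0]\<close>)
  qed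
  then show ?thesis
    using pL2 p[of n0] by (auto simp: certificates_def)
qed

text \<open>The grid minimizers have norm at most that of \<open>p\<close>, and their limit
  \<open>g\<close> is a torus certificate, hence has norm at least that of \<open>p\<close>. So the
  norms converge to that of \<open>p\<close>, and the parallelogram law upgrades this to convergence
  to \<open>p\<close>.\<close>

lemma p0_grid_tendsto:
  assumes \<phi>: "\<phi> \<in> C_torus" and x: "x ` {1..N} \<subseteq> grid n0" and a: "\<And>i. i \<in> {1..N} \<Longrightarrow> a i \<noteq> 0"
    and ex: "certificates \<phi> torus N a x \<noteq> {}"
  defines "y \<equiv> Phi \<phi> (discrete_measure N a x)"
  shows "(\<lambda>n. L2_inner (\<lambda>t. p0 \<phi> (grid n) y t - p0 \<phi> torus y t)
    (\<lambda>t. p0 \<phi> (grid n) y t - p0 \<phi> torus y t)) \<longlonglongrightarrow> 0"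
proof -
  let ?s = "\<lambda>p. L2_inner p p"
  \<comment> \<open>The shift by \<open>n0\<close> puts all \<open>x i\<close> on every grid
    considered.\<close>
  define S where "S n = certificates \<phi> (grid (n + n0)) N a x" for n
  define q where "q n = p0 \<phi> (grid (n + n0)) y" for n
  define p where "p = p0 \<phi> torus y"
  have grid_torus: "grid n \<subseteq> torus" for n
    by (auto simp: grid_iff)
  have sub: "certificates \<phi> torus N a x \<subseteq> S n" for n
    unfolding S_def by (rule certificates_antimono[OF grid_torus])
  have xn: "x ` {1..N} \<subseteq> grid (n + n0)" for n
    using x grid_mono[of n0 "n + n0"] by simp
  have q: "q n \<in> S n" "r \<in> S n \<Longrightarrow> ?s (q n) \<le> ?s r" for n r
    unfolding q_def y_def S_def using ex sub[of n] zero_in_grid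
    by (intro p0_minimal_certificate \<phi> xn a; auto simp: S_def)+
  have xt: "x ` {1..N} \<subseteq> torus"
    using x grid_torus by blast
  have "torus \<noteq> {}"
    using zero_in_torus by blast
  note p0_torus = p0_minimal_certificate[OF \<phi> xt a this ex, folded y_def, folded p_def]
  have p: "p \<in> certificates \<phi> torus N a x" "r \<in> certificates \<phi> torus N a x \<Longrightarrow> ?s p \<le> ?s r" for r
    using p0_torus by auto
  have SL2: "S n \<subseteq> L2" for n
    by (auto simp: S_def certificates_def)
  have S_dec: "decseq S"
    unfolding S_def decseq_def by (intro allI impI certificates_antimono grid_mono) simp
  have mid: "(\<lambda>t. (u t + v t) / 2) \<in> S n" if "u \<in> S n" "v \<in> S n" for u v n
    using that unfolding S_def by (rule certificates_midpoint[OF \<phi>])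
  have qp: "?s (q n) \<le> ?s p" for n
    using q(2) p(1) sub by blast
  have qL2: "q n \<in> L2" and pL2: "p \<in> L2" for n
    using q(1) p(1) sub SL2 by blast+
  obtain g where g: "g \<in> L2" and lim: "(\<lambda>n. ?s (\<lambda>t. q n t - g t)) \<longlonglongrightarrow> 0"
  proof (rule L2_almost_minimal_tendsto[OF SL2 S_dec mid q(1) _ qp])
    show "?s (q n) \<le> ?s r + 1 / Suc n" if "r \<in> S n" for n r
      using q(2)[OF that] by (rule order.trans) simp
  qed blast+
  \<comment> \<open>From index \<open>m\<close> on, the sequence stays in the closed set
    \<open>S m\<close>.\<close>
  have "g \<in> S m" for m
  proof -
    have "q (n + m) \<in> S m" for n
      using q(1)[of "n + m"] decseqD[OF S_dec, of m "n + m"] by auto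
    then show ?thesis
      unfolding S_def using LIMSEQ_ignore_initial_segment[OF lim, of m]
      by (intro certificates_closed[OF \<phi> _ g, of "\<lambda>n. q (n + m)"])
  qed
  then have "g \<in> certificates \<phi> torus N a x"
    unfolding S_def by (intro certificate_torus_if_grids[OF \<phi>, of n0]) (metis le_add_diff_inverse2)
  then have "?s p \<le> ?s g"
    by (rule p(2))
  moreover have slim: "(\<lambda>n. ?s (q n)) \<longlonglongrightarrow> ?s g"
    by (rule L2_inner_self_tendsto[OF qL2 g lim])
  then have "?s g \<le> ?s p"
    by (rule LIMSEQ_le_const2) (use qp in blast)
  ultimately have upper: "(\<lambda>n. 2 * (?s p - ?s (q n))) \<longlonglongrightarrow> 0"
    using tendsto_mult_left[OF tendsto_diff[OF tendsto_const slim], of 2 "?s p"] by simp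
  \<comment> \<open>The midpoint of \<open>q n\<close> and \<open>p\<close> belongs to
    \<open>S n\<close>, so its norm is at least that of the minimizer \<open>q n\<close>.\<close>
  have dist: "?s (\<lambda>t. q n t - p t) \<le> 2 * (?s p - ?s (q n))" for n
  proof -
    have "?s (q n) \<le> ?s (\<lambda>t. (q n t + p t) / 2)"
      using q p(1) sub by (intro q(2) mid) blast+
    then show ?thesis
      using L2_inner_self_midpoint[OF qL2 pL2, of n] by simp
  qed
  have "(\<lambda>n. ?s (\<lambda>t. q n t - p t)) \<longlonglongrightarrow> 0"
    by (rule tendsto_sandwich[OF always_eventually always_eventually tendsto_const upper])
       (intro allI L2_inner_self_nonneg dist)+
  then show ?thesis
    unfolding q_def p_def by (rule LIMSEQ_offset)
qed

text \<open>Membership in \<open>L2\<close> is asked for only eventually, since nothing is known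
  about \<open>p0\<close> on a grid that misses some \<open>x i\<close>.\<close>

lemma Phi_adj_uniform_tendsto:
  assumes f: "f \<in> C_torus" and q: "\<forall>\<^sub>F n in sequentially. q n \<in> L2" and p: "p \<in> L2"
    and lim: "(\<lambda>n. L2_inner (\<lambda>t. q n t - p t) (\<lambda>t. q n t - p t)) \<longlonglongrightarrow> 0" and e: "e > 0"
  shows "\<forall>\<^sub>F n in sequentially. \<forall>t. \<bar>Phi_adj f (q n) t - Phi_adj f p t\<bar> < e"
proof -
  obtain B where B: "\<And>t. \<bar>f t\<bar> \<le> B"
    using C_torus_bounded[OF f] by blast
  let ?b = "\<lambda>n. B * sqrt (L2_inner (\<lambda>t. q n t - p t) (\<lambda>t. q n t - p t))"
  have "?b \<longlonglongrightarrow> B * sqrt 0"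
    by (intro tendsto_intros lim)
  then have "\<forall>\<^sub>F n in sequentially. ?b n < e"
    using e by (auto dest: order_tendstoD(2))
  with q show ?thesis
  proof eventually_elim
    case (elim n)
    then show ?case
      using Phi_adj_bound[OF f B L2_diff[OF elim(1) p]]
      unfolding Phi_adj_diff[OF f elim(1) p] by (blast intro: order.strict_trans1)
  qed
qed

subsection \<open>Contact points of a strictly concave function\<close>

text \<open>Otherwise the mean value theorem gives a slope \<le> 0 to the left of \<open>c\<close>
  and a slope \<ge> 0 to its right, and applied to \<open>g'\<close> it gives a point between them
  where \<open>g''\<close> is \<ge> 0.\<close>

lemma second_derivative_neg_imp_gt_min:
  fixes g g' g'' :: "real \<Rightarrow> real"
  assumes "a < c" "c < b"
    and g: "\<And>t. (g has_field_derivative g' t) (at t)"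
    and g': "\<And>t. (g' has_field_derivative g'' t) (at t)"
    and neg: "\<And>t. a \<le> t \<Longrightarrow> t \<le> b \<Longrightarrow> g'' t < 0"
  shows "min (g a) (g b) < g c"
proof (rule ccontr)
  assume "\<not> min (g a) (g b) < g c"
  then have le: "g c \<le> g a" "g c \<le> g b"
    by auto
  obtain u where u: "a < u" "u < c" "g c - g a = (c - a) * g' u"
    using MVT2[OF assms(1), of g g'] g by blast
  obtain v where v: "c < v" "v < b" "g b - g c = (b - c) * g' v"
    using MVT2[OF assms(2), of g g'] g by blast
  obtain w where w: "u < w" "w < v" "g' v - g' u = (v - u) * g'' w"
    using MVT2[of u v g' g''] g' u v by auto
  have "(c - a) * g' u \<le> 0" "0 \<le> (b - c) * g' v"
    using le u(3) v(3) by auto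
  then have "g' u \<le> 0" "0 \<le> g' v"
    using assms(1,2) by (auto simp: mult_le_0_iff zero_le_mult_iff)
  then have "0 \<le> (v - u) * g'' w"
    using w(3) by simp
  moreover have "g'' w < 0"
    using u v w by (intro neg) auto
  ultimately show False
    using w by (auto simp: zero_le_mult_iff)
qed

text \<open>If \<open>g'' c\<close> were positive, the preceding lemma for \<open>- g\<close> around
  \<open>c\<close> would produce a value of \<open>g\<close> above the maximum.\<close>

lemma second_derivative_neg_at_max:
  fixes g g' g'' :: "real \<Rightarrow> real"
  assumes g: "\<And>t. (g has_field_derivative g' t) (at t)"
    and g': "\<And>t. (g' has_field_derivative g'' t) (at t)"
    and cont: "isCont g'' c" and max: "\<And>t. g t \<le> g c" and nz: "g'' c \<noteq> 0"
  shows "g'' c < 0"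
proof (rule ccontr)
  assume "\<not> g'' c < 0"
  then have "0 < g'' c"
    using nz by simp
  then have "\<forall>\<^sub>F t in nhds c. 0 < g'' t"
    using cont by (intro order_tendstoD(1)[of g'' "g'' c"]) (auto simp: isCont_def tendsto_at_iff_tendsto_nhds)
  then obtain d where d: "d > 0" "\<And>t. dist t c < d \<Longrightarrow> 0 < g'' t"
    by (auto simp: eventually_nhds_metric)
  have "min (- g (c - d / 2)) (- g (c + d / 2)) < - g c"
  proof (rule second_derivative_neg_imp_gt_min[of "c - d / 2" c "c + d / 2" "\<lambda>t. - g t" "\<lambda>t. - g' t" "\<lambda>t. - g'' t"])
    show "- g'' t < 0" if "c - d / 2 \<le> t" "t \<le> c + d / 2" for t
      using d(2)[of t] d(1) that by (auto simp: dist_real_def abs_if)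
  qed (use d(1) in \<open>auto intro!: derivative_intros g g'\<close>)
  then show False
    using max[of "c - d / 2"] max[of "c + d / 2"] by auto
qed

text \<open>Otherwise strict concavity would make \<open>g\<close> exceed 1 at an intermediate lattice point.\<close>

lemma concave_contact_points:
  fixes g g' g'' :: "real \<Rightarrow> real"
  assumes g: "\<And>t. (g has_field_derivative g' t) (at t)"
    and g': "\<And>t. (g' has_field_derivative g'' t) (at t)"
    and neg: "\<And>t. \<bar>t - c\<bar> \<le> r \<Longrightarrow> g'' t < 0"
    and le: "\<And>k::int. g (c + of_int k * h) \<le> 1" and c: "g c = 1" and h: "h > 0"
  shows "g (c + of_int k * h) = 1 \<Longrightarrow> \<bar>of_int k * h\<bar> \<le> r \<Longrightarrow> k \<in> {-1, 0, 1}"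
    and "h \<le> r \<Longrightarrow> \<not> (g (c - h) = 1 \<and> g (c + h) = 1)"
proof -
  assume k: "g (c + of_int k * h) = 1" "\<bar>of_int k * h\<bar> \<le> r"
  show "k \<in> {-1, 0, 1}"
  proof (rule ccontr)
    assume "k \<notin> {-1, 0, 1}"
    then consider "k \<ge> 2" | "k \<le> -2"
      by fastforce
    then show False
    proof cases
      case 1
      have "1 * h < of_int k * h"
        using 1 h by (intro mult_strict_right_mono) auto
      then have "min (g c) (g (c + of_int k * h)) < g (c + h)"
        using h k(2) by (intro second_derivative_neg_imp_gt_min[OF _ _ g g'] neg) auto
      then show False
        using le[of 1] c k(1) by simp
    next
      case 2
      have "of_int k * h < (- 1) * h"
        using 2 h by (intro mult_strict_right_mono) auto
      then have "min (g (c + of_int k * h)) (g c) < g (c - h)"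
        using h k(2) by (intro second_derivative_neg_imp_gt_min[OF _ _ g g'] neg) auto
      then show False
        using le[of "-1"] c k(1) by simp
    qed
  qed
next
  assume "h \<le> r"
  then have "min (g (c - h)) (g (c + h)) < g c"
    using h by (intro second_derivative_neg_imp_gt_min[OF _ _ g g'] neg) auto
  then show "\<not> (g (c - h) = 1 \<and> g (c + h) = 1)"
    using c by auto
qed

text \<open>Compactness turns the pointwise strict inequality into a uniform gap. Distances are
  taken to all integer translates, as a point near 1 is close to a support point at 0.\<close>

lemma C_torus_lt_one_away_from:
  fixes x :: "'i \<Rightarrow> real"
  assumes f: "f \<in> C_torus" and lt: "\<And>t. t \<in> torus - x ` I \<Longrightarrow> \<bar>f t\<bar> < 1" and r: "r > 0"
  obtains d where "d > 0"
    "\<And>t. t \<in> torus \<Longrightarrow> (\<And>i z. i \<in> I \<Longrightarrow> r \<le> \<bar>t + of_int z - x i\<bar>) \<Longrightarrow> \<bar>f t\<bar> \<le> 1 - d"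
proof -
  \<comment> \<open>The closed interval is used because \<open>torus\<close>, a half-open interval,
    is not compact; \<open>frac\<close> carries the hypothesis over to the endpoint 1.\<close>
  define K where "K = {0..1} \<inter> (\<Inter>i\<in>I. \<Inter>z::int. {t. r \<le> \<bar>t + of_int z - x i\<bar>})"
  have "compact K"
    unfolding K_def by (intro compact_Int_closed compact_Icc closed_INT ballI closed_Collect_le continuous_intros)
  have lt1: "\<bar>f t\<bar> < 1" if "t \<in> K" for t
  proof -
    have "frac t \<noteq> x i" if "i \<in> I" for i
    proof -
      have "r \<le> \<bar>t + of_int (- \<lfloor>t\<rfloor>) - x i\<bar>"
        using \<open>t \<in> K\<close> that unfolding K_def by blast
      then show ?thesis
        using r by (auto simp: frac_def)
    qed
    then have "\<bar>f (frac t)\<bar> < 1"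
      by (intro lt) auto
    then show ?thesis
      using C_torus_frac[OF f] by simp
  qed
  have "\<exists>d>0. \<forall>t\<in>K. \<bar>f t\<bar> \<le> 1 - d"
  proof (cases "K = {}")
    case True
    then show ?thesis
      by (auto intro: exI[of _ 1])
  next
    case False
    then obtain s where s: "s \<in> K" "\<And>t. t \<in> K \<Longrightarrow> \<bar>f t\<bar> \<le> \<bar>f s\<bar>"
      using continuous_attains_sup[OF \<open>compact K\<close> False, of "\<lambda>t. \<bar>f t\<bar>"] C_torus_continuous[OF f]
        continuous_on_rabs by blast
    then show ?thesis
      using lt1[OF s(1)] by (intro exI[of _ "1 - \<bar>f s\<bar>"]) auto
  qed
  then obtain d where d: "d > 0" "\<And>t. t \<in> K \<Longrightarrow> \<bar>f t\<bar> \<le> 1 - d"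
    by blast
  show ?thesis
  proof (rule that[OF d(1) d(2)])
    show "t \<in> K" if "t \<in> torus" "\<And>i z. i \<in> I \<Longrightarrow> r \<le> \<bar>t + of_int z - x i\<bar>" for t
      using that by (auto simp: K_def torus_def)
  qed
qed

section \<open>Lattice translations modulo 1\<close>

lemma frac_add_int: "frac (t + of_int z) = (frac t :: real)"
  by (simp add: frac_def)

lemma frac_torus: "t \<in> torus \<Longrightarrow> frac t = t"
  by (simp add: torus_def frac_eq)

lemma grid_frac_shift:
  assumes "t \<in> grid n"
  shows "frac (t + of_int k / 2 ^ n) \<in> grid n"
proof -
  have "frac (t + of_int k / 2 ^ n) * 2 ^ n =
      t * 2 ^ n + of_int k - of_int (\<lfloor>t + of_int k / 2 ^ n\<rfloor> * 2 ^ n)"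
    by (simp add: frac_def algebra_simps)
  also have "\<dots> \<in> \<int>"
    using assms by (intro Ints_diff Ints_add Ints_of_int) (simp add: grid_iff)
  finally show ?thesis
    by (simp add: grid_iff)
qed

text \<open>The integer \<open>z\<close> covers the case where \<open>t\<close> is close to
  \<open>s\<close> only across the point 0 = 1 of the torus.\<close>

lemma grid_diff:
  assumes "s \<in> grid n" "t \<in> grid n"
  obtains k :: int where "t + of_int z = s + of_int k / 2 ^ n"
proof -
  have "t * 2 ^ n + of_int (z * 2 ^ n) - s * 2 ^ n \<in> \<int>"
    using assms by (intro Ints_diff Ints_add Ints_of_int) (simp_all add: grid_iff)
  then obtain k where "t * 2 ^ n + of_int (z * 2 ^ n) - s * 2 ^ n = of_int k"
    by (auto elim: Ints_cases)
  then have "t + of_int z = s + of_int k / 2 ^ n"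
    by (simp add: field_simps)
  then show ?thesis
    by (rule that)
qed

section \<open>The two inclusions on fine grids\<close>

theorem proposition11:
  fixes \<phi> :: "real \<Rightarrow> real" and N :: nat and a x :: "nat \<Rightarrow> real"
  assumes "\<phi> \<in> C2_torus"
    and "\<And>i. i \<in> {1..N} \<Longrightarrow> a i \<noteq> 0"
    and "inj_on x {1..N}"
    and "dyadic N x"
    and "NDSC \<phi> N a x"
  shows "\<forall>\<^sub>F n in sequentially. \<exists>\<epsilon> :: nat \<Rightarrow> real. (\<forall>i\<in>{1..N}. \<epsilon> i \<in> {1, -1}) \<and>
    signed_supp N a x \<subseteq> extended_supp \<phi> N a x n \<and>
    extended_supp \<phi> N a x n \<subseteq> signed_supp N a x \<union> shifted_supp \<phi> N a x n \<epsilon>"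
proof -
  note \<phi> = C2_torusD[OF assms(1)] and a = assms(2)
  let ?I = "{1..N}"
  define y where "y = Phi \<phi> (discrete_measure N a x)"
  define p where "p = p0 \<phi> torus y"
  define \<eta> where "\<eta> = Phi_adj \<phi> p"
  define \<eta>2 where "\<eta>2 = Phi_adj (deriv (deriv \<phi>)) p"
  define q where "q n = p0 \<phi> (grid n) y" for n
  define e where "e n = Phi_adj \<phi> (q n)" for n
  define e1 where "e1 n = Phi_adj (deriv \<phi>) (q n)" for n
  define e2 where "e2 n = Phi_adj (deriv (deriv \<phi>)) (q n)" for n
  define s where "s i = sgn (a i)" for i
  have e_eq: "eta0_grid \<phi> N a x n = e n" for n
    by (simp add: eta0_grid_def eta0_def e_def q_def y_def)
  have eta_eq: "eta0 \<phi> torus y = \<eta>"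
    by (simp add: eta0_def \<eta>_def p_def)
  have s: "s i = 1 \<or> s i = - 1" if "i \<in> ?I" for i
    using a[OF that] by (auto simp: s_def sgn_if)
  obtain n0 where n0: "x ` ?I \<subseteq> grid n0"
    using assms(4) by (auto simp: dyadic_def)
  have grid_torus: "grid n \<subseteq> torus" for n
    by (auto simp: grid_iff)
  have xt: "x ` ?I \<subseteq> torus"
    using n0 grid_torus by blast
  \<comment> \<open>The source condition enters here: a subgradient in the range of the adjoint
    takes the value \<open>sgn (a i)\<close> at \<open>x i\<close>, so its preimage is a
    certificate.\<close>
  have ex: "certificates \<phi> torus N a x \<noteq> {}"
  proof -
    obtain p' where p': "p' \<in> L2" "Phi_adj \<phi> p' \<in> TV_subdiff (discrete_measure N a x)"
      using assms(5) by (auto simp: NDSC_def Let_def)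
    have "p' \<in> certificates \<phi> torus N a x"
      using p' TV_subdiff_discrete_measure[OF p'(2) assms(3) xt] a
      by (auto simp: certificates_def TV_subdiff_def sup_norm_torus_le_one_iff)
    then show ?thesis by blast
  qed
  have "torus \<noteq> {}"
    using zero_in_torus by blast
  then have p: "p \<in> certificates \<phi> torus N a x"
    unfolding p_def y_def using \<phi>(1) xt a ex by (intro p0_minimal_certificate(1)) auto
  then have pL2: "p \<in> L2" and \<eta>_x: "\<And>i. i \<in> ?I \<Longrightarrow> \<eta> (x i) = s i"
    by (auto simp: certificates_def \<eta>_def s_def)
  have \<eta>C: "\<eta> \<in> C_torus" and \<eta>2C: "\<eta>2 \<in> C_torus"
    unfolding \<eta>_def \<eta>2_def using \<phi> pL2 by (auto intro: Phi_adj_C_torus)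
  have \<eta>1: "\<bar>\<eta> t\<bar> \<le> 1" for t
  proof -
    have "\<bar>\<eta> (frac t)\<bar> \<le> 1"
      using p frac_in_torus[of t] unfolding certificates_def \<eta>_def by blast
    then show ?thesis
      by (simp add: C_torus_frac[OF \<eta>C])
  qed
  have \<eta>_lt: "\<bar>\<eta> t\<bar> < 1" if "t \<in> torus - x ` ?I" for t
    using assms(5) that by (auto simp: NDSC_def Let_def eta_eq simp flip: y_def)
  have \<eta>2_nz: "\<eta>2 (x i) \<noteq> 0" if "i \<in> ?I" for i
    using assms(5) that deriv_deriv_Phi_adj(3)[OF assms(1) pL2]
    by (auto simp: NDSC_def Let_def eta_eq \<eta>_def \<eta>2_def simp flip: y_def)
  have cont: "isCont f t" if "f \<in> C_torus" for f t
    using C_torus_continuous[OF that, of UNIV] by (simp add: continuous_on_eq_continuous_at)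
  have neg: "s i * \<eta>2 (x i) < 0" if i: "i \<in> ?I" for i
  proof (rule second_derivative_neg_at_max[of "\<lambda>t. s i * \<eta> t" "\<lambda>t. s i * Phi_adj (deriv \<phi>) p t"
        "\<lambda>t. s i * \<eta>2 t" "x i"])
    show "((\<lambda>t. s i * \<eta> t) has_field_derivative s i * Phi_adj (deriv \<phi>) p t) (at t)"
      "((\<lambda>t. s i * Phi_adj (deriv \<phi>) p t) has_field_derivative s i * \<eta>2 t) (at t)" for t
      unfolding \<eta>_def \<eta>2_def by (intro DERIV_cmult deriv_deriv_Phi_adj assms(1) pL2)+
    show "isCont (\<lambda>t. s i * \<eta>2 t) (x i)"
      by (intro continuous_intros cont \<eta>2C)
    show "s i * \<eta> t \<le> s i * \<eta> (x i)" for t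
      using s[OF i] \<eta>1[of t] \<eta>_x[OF i] by (auto simp: abs_le_iff)
    show "s i * \<eta>2 (x i) \<noteq> 0"
      using s[OF i] \<eta>2_nz[OF i] by auto
  qed
  \<comment> \<open>The filter \<open>at_right 0\<close> yields one radius for the finitely many
    \<open>i\<close>. Half of the second derivative at \<open>x i\<close> is kept as a margin for
    the perturbation, and the bound 1/2 will determine the sign at a contact point.\<close>
  have "\<forall>\<^sub>F r in at_right 0. \<forall>i\<in>?I. \<forall>u. \<bar>u - x i\<bar> \<le> r \<longrightarrow>
      s i * \<eta>2 u < s i * \<eta>2 (x i) / 2 \<and> 1 / 2 < s i * \<eta> u"
  proof (rule eventually_ball_finite, simp, rule ballI)
    fix i assume i: "i \<in> ?I"
    have "\<forall>\<^sub>F u in nhds (x i). s i * \<eta>2 u < s i * \<eta>2 (x i) / 2"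
      using neg[OF i] cont[OF \<eta>2C, of "x i"]
      by (intro order_tendstoD(2)[of _ "s i * \<eta>2 (x i)"] tendsto_intros) (auto simp: isCont_def tendsto_at_iff_tendsto_nhds)
    moreover have "s i * \<eta> (x i) = 1"
      using s[OF i] \<eta>_x[OF i] by auto
    then have "\<forall>\<^sub>F u in nhds (x i). 1 / 2 < s i * \<eta> u"
      using cont[OF \<eta>C, of "x i"]
      by (intro order_tendstoD(1)[of _ "s i * \<eta> (x i)"] tendsto_intros) (auto simp: isCont_def tendsto_at_iff_tendsto_nhds)
    ultimately have "\<forall>\<^sub>F u in nhds (x i). s i * \<eta>2 u < s i * \<eta>2 (x i) / 2 \<and> 1 / 2 < s i * \<eta> u"
      by (rule eventually_conj)
    then obtain d where "d > 0"
      "\<And>u. dist u (x i) < d \<Longrightarrow> s i * \<eta>2 u < s i * \<eta>2 (x i) / 2 \<and> 1 / 2 < s i * \<eta> u"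
      by (auto simp: eventually_nhds_metric)
    then show "\<forall>\<^sub>F r in at_right 0. \<forall>u. \<bar>u - x i\<bar> \<le> r \<longrightarrow>
        s i * \<eta>2 u < s i * \<eta>2 (x i) / 2 \<and> 1 / 2 < s i * \<eta> u"
      unfolding eventually_at_right_field dist_real_def by (meson order.strict_trans1)
  qed
  then have "\<exists>r>0. \<forall>i\<in>?I. \<forall>u. \<bar>u - x i\<bar> \<le> r \<longrightarrow>
      s i * \<eta>2 u < s i * \<eta>2 (x i) / 2 \<and> 1 / 2 < s i * \<eta> u"
    unfolding eventually_at_right_field by (meson dense)
  then obtain r where r: "r > 0"
    "\<And>i u. i \<in> ?I \<Longrightarrow> \<bar>u - x i\<bar> \<le> r \<Longrightarrow> s i * \<eta>2 u < s i * \<eta>2 (x i) / 2"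
    "\<And>i u. i \<in> ?I \<Longrightarrow> \<bar>u - x i\<bar> \<le> r \<Longrightarrow> 1 / 2 < s i * \<eta> u"
    by blast
  obtain d where d: "d > 0"
    "\<And>t. t \<in> torus \<Longrightarrow> (\<And>i z. i \<in> ?I \<Longrightarrow> r \<le> \<bar>t + of_int z - x i\<bar>) \<Longrightarrow> \<bar>\<eta> t\<bar> \<le> 1 - d"
    using C_torus_lt_one_away_from[OF \<eta>C \<eta>_lt r(1)] by blast
  have q: "q n \<in> certificates \<phi> (grid n) N a x" if "n \<ge> n0" for n
    unfolding q_def y_def
  proof (intro p0_minimal_certificate(1) \<phi>(1) a)
    show "x ` ?I \<subseteq> grid n"
      using n0 grid_mono[OF that] by blast
    show "certificates \<phi> (grid n) N a x \<noteq> {}"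
      using ex certificates_antimono[OF grid_torus] by blast
    show "grid n \<noteq> {}"
      using zero_in_grid by blast
  qed
  then have "\<forall>\<^sub>F n in sequentially. q n \<in> L2"
    by (auto simp: eventually_sequentially certificates_def)
  moreover have "(\<lambda>n. L2_inner (\<lambda>t. q n t - p t) (\<lambda>t. q n t - p t)) \<longlonglongrightarrow> 0"
    unfolding q_def p_def y_def using \<phi>(1) n0 a ex by (intro p0_grid_tendsto) auto
  ultimately have unif: "\<forall>\<^sub>F n in sequentially. \<forall>t. \<bar>Phi_adj f (q n) t - Phi_adj f p t\<bar> < c"
    if "f \<in> C_torus" "c > 0" for f c
    using that pL2 by (intro Phi_adj_uniform_tendsto)
  \<comment> \<open>Closeness within \<open>d\<close> excludes contact away from the support;
    closeness within 1/2 forces a contact value near \<open>x i\<close> to be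
    \<open>s i\<close>.\<close>
  have "\<forall>\<^sub>F n in sequentially. \<forall>t. \<bar>e n t - \<eta> t\<bar> < min d (1 / 2)"
    unfolding e_def \<eta>_def using d(1) by (intro unif \<phi>) simp
  \<comment> \<open>The tolerance is exactly the margin kept in the choice of \<open>r\<close>, so
    \<open>s i * e2 n\<close> stays negative within distance \<open>r\<close> of
    \<open>x i\<close>.\<close>
  moreover have "\<forall>\<^sub>F n in sequentially. \<forall>i\<in>?I. \<forall>t. \<bar>e2 n t - \<eta>2 t\<bar> < \<bar>\<eta>2 (x i)\<bar> / 2"
    unfolding e2_def \<eta>2_def
    by (intro eventually_ball_finite ballI unif \<phi>) (use \<eta>2_nz in \<open>auto simp: \<eta>2_def\<close>)
  ultimately show ?thesis
    using eventually_ge_at_top[of n0]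
  proof eventually_elim
    case (elim n)
    let ?h = "1 / 2 ^ n :: real"
    have qn: "q n \<in> certificates \<phi> (grid n) N a x" and qL2: "q n \<in> L2"
      using q[OF elim(3)] by (auto simp: certificates_def)
    have eC: "e n \<in> C_torus"
      unfolding e_def by (intro Phi_adj_C_torus \<phi> qL2)
    have e_grid: "\<bar>e n t\<bar> \<le> 1" if "t \<in> grid n" for t
      using qn that by (auto simp: certificates_def e_def)
    have e_x: "e n (x i) = s i" if "i \<in> ?I" for i
      using qn that by (auto simp: certificates_def e_def s_def)
    have x_grid: "x i \<in> grid n" if "i \<in> ?I" for i
      using that n0 grid_mono[OF elim(3)] by blast
    have contact: "(s i * e n (x i + of_int k * ?h) = 1 \<longrightarrow> \<bar>of_int k * ?h\<bar> \<le> r \<longrightarrow> k \<in> {-1, 0, 1}) \<and>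
        (?h \<le> r \<longrightarrow> \<not> (s i * e n (x i - ?h) = 1 \<and> s i * e n (x i + ?h) = 1))" if i: "i \<in> ?I" for i k
    proof -
      have D: "((\<lambda>t. s i * e n t) has_field_derivative s i * e1 n t) (at t)"
        "((\<lambda>t. s i * e1 n t) has_field_derivative s i * e2 n t) (at t)" for t
        unfolding e_def e1_def e2_def by (intro DERIV_cmult deriv_deriv_Phi_adj assms(1) qL2)+
      have "s i * e2 n t < 0" if "\<bar>t - x i\<bar> \<le> r" for t
      proof -
        have "\<bar>e2 n t - \<eta>2 t\<bar> < \<bar>\<eta>2 (x i)\<bar> / 2"
          using elim(2) i by blast
        then show ?thesis
          using s[OF i] r(2)[OF i that] neg[OF i]
            abs_ge_self[of "e2 n t - \<eta>2 t"] abs_ge_minus_self[of "e2 n t - \<eta>2 t"] by auto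
      qed
      \<comment> \<open>Modulo 1 the lattice through \<open>x i\<close> consists of grid points,
        where alone the bound 1 is available.\<close>
      moreover have "s i * e n (x i + of_int k * ?h) \<le> 1" for k :: int
      proof -
        have "\<bar>e n (x i + of_int k * ?h)\<bar> \<le> 1"
          using e_grid[OF grid_frac_shift[OF x_grid[OF i], of k]] C_torus_frac[OF eC] by simp
        then show ?thesis
          using s[OF i] by (auto simp: abs_le_iff)
      qed
      moreover have "s i * e n (x i) = 1"
        using s[OF i] e_x[OF i] by auto
      ultimately show ?thesis
        using concave_contact_points[of "\<lambda>t. s i * e n t" "\<lambda>t. s i * e1 n t" "\<lambda>t. s i * e2 n t" "x i" r ?h, OF D]
        by simp
    qed
    \<comment> \<open>At most one neighbour of \<open>x i\<close> is a contact point once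
      \<open>?h \<le> r\<close>. The value 1 is also the default when neither is, which is harmless
      for an inclusion.\<close>
    define \<epsilon> :: "nat \<Rightarrow> real" where "\<epsilon> i = (if e n (x i - ?h) = s i then - 1 else 1)" for i
    have "(t, v) \<in> signed_supp N a x \<union> shifted_supp \<phi> N a x n \<epsilon>" if tv: "(t, v) \<in> extended_supp \<phi> N a x n" for t v
    proof -
      have t: "t \<in> grid n" "t \<in> torus" and v: "v = 1 \<or> v = - 1" "e n t = v"
        using tv grid_torus by (auto simp: extended_supp_def e_eq)
      \<comment> \<open>A contact value has modulus 1 and \<open>e n\<close> differs from \<eta> by
        less than \<open>d\<close>.\<close>
      have "\<not> \<bar>\<eta> t\<bar> \<le> 1 - d"
        using elim(1)[rule_format, of t] v by auto
      then obtain i z where i: "i \<in> ?I" and z: "\<bar>t + of_int z - x i\<bar> < r"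
        using d(2)[OF t(2)] by (meson not_less)
      obtain k where k: "t + of_int z = x i + of_int k / 2 ^ n"
        using grid_diff[OF x_grid[OF i] t(1)] by blast
      have ek: "e n (x i + of_int k / 2 ^ n) = v"
        using v(2) C_torus_plus_int[OF eC, of t z] k by simp
      have tk: "t = frac (x i + of_int k / 2 ^ n)"
        using frac_torus[OF t(2)] frac_add_int[of t z] k by simp
      have "1 / 2 < s i * \<eta> (x i + of_int k / 2 ^ n)"
        by (rule r(3)[OF i]) (use z k in simp)
      then have vs: "v = s i"
        using elim(1)[rule_format, of "x i + of_int k / 2 ^ n"] ek v(1) s[OF i] by auto
      have kr: "\<bar>of_int k * ?h\<bar> \<le> r"
        using z k by simp
      have "k \<in> {-1, 0, 1}"
        using contact[OF i, of k] kr ek vs s[OF i] by auto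
      then consider "k = 0" | "k \<noteq> 0" "of_int k = \<epsilon> i"
      proof (cases "k = 1")
        case True
        \<comment> \<open>For \<open>k = 1\<close> the bound \<open>kr\<close> reads
          \<open>?h \<le> r\<close>, so contact on both sides is excluded.\<close>
        then have "\<not> s i * e n (x i - ?h) = 1"
          using contact[OF i, of 1] kr ek vs s[OF i] by auto
        then have "\<epsilon> i = 1"
          using s[OF i] by (auto simp: \<epsilon>_def)
        with True show ?thesis
          by (intro that(2)) auto
      next
        case False
        have "\<epsilon> i = - 1" if "k = - 1"
          using that ek vs by (simp add: \<epsilon>_def)
        with False \<open>k \<in> {-1, 0, 1}\<close> show ?thesis
          using that by auto
      qed
      then show ?thesis
      proof cases
        case 1
        then have "t = x i"
          using tk x_grid[OF i] grid_torus[of n] frac_torus[of "x i"] by auto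
        then show ?thesis
          using i vs by (auto simp: signed_supp_def s_def)
      next
        case 2
        then show ?thesis
          using i vs tk e_x[OF i] by (auto simp: shifted_supp_def e_eq)
      qed
    qed
    moreover have "signed_supp N a x \<subseteq> extended_supp \<phi> N a x n"
      using x_grid e_x s by (auto simp: signed_supp_def extended_supp_def e_eq s_def)
    moreover have "\<forall>i\<in>?I. \<epsilon> i \<in> {1, - 1}"
      by (simp add: \<epsilon>_def)
    ultimately show ?case
      by (intro exI[of _ \<epsilon>]) (simp add: subrelI)
  qed
qed

end
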